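(* Let $(C,0)$ be a unibranch curve, let $n,k\ge 1$ and let $I \in \operatorname{Hilb}^n_{0,k}(C)$. Then there exists a minimal set of generators $g_1,\dots,g_k$ of $I$ such that the valuations $n_i=\operatorname{val}_t(g_i)$ form an independent $k$-uple, and this is the only possible independent $k$-uple of valuations arising from minimal sets of generators of $I$.
   Context: $\mathbb K$ is an algebraically closed field of characteristic zero. A unibranch curve $(C,0)$ is a plane curve germ $\{f=0\}$ with $f\in\mathbb K[[x,y]]$ irreducible and $f(0)=0$. Via a (non-degenerate) Puiseux parameterization $(p_C,q_C)=(t^{e},\sum_{m\ge e}a_mt^m)$, $e=\operatorname{mult}_C$, $f(p_C,q_C)=0$, one has $\mathcal O:=\widehat{\mathcal O}_{C,0}=\mathbb K[[x,y]]/(f)\cong\mathbb K[[p_C,q_C]]\subseteq\mathbb K[[t]]$. The $t$-adic valuation is $\operatorname{val}_t$, and for an ideal $J\subseteq\mathcal O$, $\operatorname{val}_t(J)$ is the set of valuations of its nonzero elements. $\operatorname{Hilb}^n_{0}(C)=\{I\subseteq\mathcal O \text{ ideal}\mid\dim_{\mathbb K}\mathcal O/I=n\}$, and $\operatorname{Hilb}^n_{0,k}(C)=\{I\in\operatorname{Hilb}^n_0(C)\mid \dim_{\mathbb K}I/m_0I=k\}$, where $m_0$ is the maximal ideal of $\mathcal O$; by Nakayama, $k$ is the minimal number of generators of $I$. Independence: given a minimal set of generators $g_1,\dots,g_k$ of $I$ with $\operatorname{val}_t(g_i)=n_i$, ordered so that $n_1\le\dots\le n_k$, put $\Delta_{g_i}=\operatorname{val}_t\big((g_1,\dots,g_{i-1},g_{i+1},\dots,g_k)\big)$.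 The valuations form an independent $k$-uple if $n_i\notin\Delta_{g_i}$ for every $i=1,\dots,k$. *)

theory Defs
  imports
    "HOL-Algebra.Embedded_Algebras"
    "HOL-Algebra.Ideal_Product"
    "HOL-Algebra.QuotRing"
    "HOL-Algebra.Algebraic_Closure_Type"
    "HOL-Computational_Algebra.Formal_Power_Series"
begin

text \<open>
  \<open>\<bbbK>[[x,y]]\<close> is the type \<open>'a fps fps\<close> (power series in \<open>y\<close> over \<open>\<bbbK>[[x]]\<close>): the coefficient of
  \<open>x\<^sup>i y\<^sup>j\<close> in \<open>f\<close> is \<open>f $ j $ i\<close>.
\<close>

definition unibranch :: "'a::field fps fps \<Rightarrow> bool" where
  "unibranch f \<longleftrightarrow> Factorial_Ring.irreducible f \<and> f $ 0 $ 0 = 0"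

definition curve_mult :: "'a::field fps fps \<Rightarrow> nat" where
  "curve_mult f = (LEAST d. \<exists>i j. i + j = d \<and> f $ j $ i \<noteq> 0)"

text \<open>
  The substitution \<open>h(p,q) = \<Sum>\<^sub>j h\<^sub>j(p) q\<^sup>j\<close>, meaningful for \<open>p\<close>, \<open>q\<close> without constant term;
  then only the terms with \<open>j \<le> n\<close> contribute to the \<open>n\<close>-th coefficient.
\<close>

definition subst2 :: "'a::field fps \<Rightarrow> 'a fps \<Rightarrow> 'a fps fps \<Rightarrow> 'a fps" where
  "subst2 p q h = Abs_fps (\<lambda>n. \<Sum>j\<le>n. ((h $ j oo p) * q ^ j) $ n)"

text \<open>
  \<open>(t\<^sup>e, \<Sum>\<^sub>m\<^sub>\<ge>\<^sub>e a\<^sub>m t\<^sup>m)\<close>, non-degenerate: not a pair of power series in some \<open>t\<^sup>d\<close> with \<open>d > 1\<close>.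
\<close>

definition puiseux_pair :: "nat \<Rightarrow> 'a::field fps \<Rightarrow> 'a fps \<Rightarrow> bool" where
  "puiseux_pair e p q \<longleftrightarrow>
     p = fps_X ^ e \<and> (\<forall>m<e. q $ m = 0) \<and> Gcd (insert e {m. q $ m \<noteq> 0}) = 1"

text \<open>
  A curve tangent to the line \<open>x = 0\<close> need not have a parameterization with first component
  \<open>t\<^sup>e\<close>, \<open>e\<close> the multiplicity (e.g.\ \<open>f = x\<close>); it has one after exchanging the coordinates. Both
  cases are admitted, so that every unibranch curve has a parameterization in this sense.
\<close>

definition puiseux_param :: "'a::field fps fps \<Rightarrow> 'a fps \<Rightarrow> 'a fps \<Rightarrow> bool" where
  "puiseux_param f p q \<longleftrightarrow>
     (puiseux_pair (curve_mult f) p q \<or> puiseux_pair (curve_mult f) q p) \<and> subst2 p q f = 0"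

abbreviation fps2_ring :: "'a::field fps fps ring" where
  "fps2_ring \<equiv> ring_of_type_algebra"

definition curve_ring :: "'a::field fps fps \<Rightarrow> 'a fps fps set ring" where
  "curve_ring f = fps2_ring Quot (PIdl\<^bsub>fps2_ring\<^esub> f)"

definition max_ideal :: "'a::field fps fps \<Rightarrow> 'a fps fps set set" where
  "max_ideal f = (THE m. maximalideal m (curve_ring f))"

definition scalar :: "'a::field fps fps \<Rightarrow> 'a \<Rightarrow> 'a fps fps set" where
  "scalar f c = (PIdl\<^bsub>fps2_ring\<^esub> f) +>\<^bsub>fps2_ring\<^esub> fps_const (fps_const c)"

text \<open>
  \<open>dim\<^sub>\<bbbK> V/W = d\<close> for ideals \<open>W \<subseteq> V\<close> of \<open>\<O>\<close>: the space \<open>V/W\<close> is the image of \<open>V\<close> in the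
  ring \<open>\<O>/W\<close>, and \<open>\<bbbK>\<close> acts through its image in that ring.
\<close>

definition quot_dim ::
  "'a::field fps fps \<Rightarrow> 'a fps fps set set \<Rightarrow> 'a fps fps set set \<Rightarrow> nat \<Rightarrow> bool" where
  "quot_dim f V W d \<longleftrightarrow>
     ring.dimension (curve_ring f Quot W) d
       (range (\<lambda>c. W +>\<^bsub>curve_ring f\<^esub> scalar f c))
       ((\<lambda>v. W +>\<^bsub>curve_ring f\<^esub> v) ` V)"

definition Hilb :: "'a::field fps fps \<Rightarrow> nat \<Rightarrow> 'a fps fps set set set" where
  "Hilb f n = {I. ideal I (curve_ring f) \<and> quot_dim f (carrier (curve_ring f)) I n}"

definition Hilb_gen :: "'a::field fps fps \<Rightarrow> nat \<Rightarrow> nat \<Rightarrow> 'a fps fps set set set" where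
  "Hilb_gen f n k =
     {I \<in> Hilb f n. quot_dim f I (max_ideal f \<cdot>\<^bsub>curve_ring f\<^esub> I) k}"

text \<open>
  Elements of \<open>\<O>\<close> are cosets; if \<open>f(p,q) = 0\<close>, substitution is constant on each of them and this
  is the map \<open>\<O> \<rightarrow> \<bbbK>[[t]]\<close> with image \<open>\<bbbK>[[p,q]]\<close>.
\<close>

definition param_map :: "'a::field fps \<Rightarrow> 'a fps \<Rightarrow> 'a fps fps set \<Rightarrow> 'a fps" where
  "param_map p q a = the_elem (subst2 p q ` a)"

text \<open>Only meaningful for nonzero elements, since \<open>subdegree 0 = 0\<close>.\<close>

definition val_t :: "'a::field fps \<Rightarrow> 'a fps \<Rightarrow> 'a fps fps set \<Rightarrow> nat" where
  "val_t p q a = subdegree (param_map p q a)"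

definition val_set ::
  "'a::field fps fps \<Rightarrow> 'a fps \<Rightarrow> 'a fps \<Rightarrow> 'a fps fps set set \<Rightarrow> nat set" where
  "val_set f p q J = val_t p q ` (J - {\<zero>\<^bsub>curve_ring f\<^esub>})"

definition minimal_generators ::
  "'a::field fps fps \<Rightarrow> 'a fps fps set set \<Rightarrow> 'a fps fps set list \<Rightarrow> bool" where
  "minimal_generators f I gs \<longleftrightarrow>
     distinct gs \<and> set gs \<subseteq> carrier (curve_ring f) \<and> Idl\<^bsub>curve_ring f\<^esub> (set gs) = I \<and>
     (\<forall>S. S \<subset> set gs \<longrightarrow> Idl\<^bsub>curve_ring f\<^esub> S \<noteq> I)"

definition independent_valuations ::
  "'a::field fps fps \<Rightarrow> 'a fps \<Rightarrow> 'a fps \<Rightarrow> 'a fps fps set list \<Rightarrow> bool" where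
  "independent_valuations f p q gs \<longleftrightarrow>
     sorted (map (val_t p q) gs) \<and>
     (\<forall>i<length gs. val_t p q (gs ! i) \<notin>
        val_set f p q (Idl\<^bsub>curve_ring f\<^esub> ((!) gs ` ({..<length gs} - {i}))))"

end

theory Submission
  imports Defs
begin

text \<open>
  Substituting the parameterization identifies \<open>\<O>\<close> with a subalgebra \<open>A \<subseteq> \<bbbK>[[t]]\<close>, and ideals of \<open>\<O>\<close>
  with ideals of \<open>A\<close>. Write \<open>m\<close> for the maximal ideal, the elements of \<open>A\<close> of positive valuation,
  and \<open>S = val(I) \<setminus> val(m I)\<close>. The theorem holds because the increasing enumeration of \<open>S\<close> is the
  only possible independent tuple, and because it does occur.

  The engine is \<open>ideal_eq_if_vals\<close>: if \<open>J \<subseteq> I\<close> are ideals of \<open>A\<close> and every valuation of \<open>I\<close> is one of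
  \<open>J\<close>, then \<open>J = I\<close>. Given \<open>h \<in> I\<close>, one subtracts elements of \<open>J\<close> that cancel the leading terms one
  after the other; as \<open>A\<close> contains \<open>\<bbbK>[[t\<^sup>e]]\<close>, with \<open>e\<close> the multiplicity, only one element of \<open>J\<close> for
  each residue modulo \<open>e\<close> is needed, and the infinitely many subtractions combine into finitely many
  coefficients in \<open>\<bbbK>[[t\<^sup>e]]\<close>.

  Choose \<open>g\<^sub>s \<in> I\<close> of valuation \<open>s\<close> for each \<open>s \<in> S\<close>. A nontrivial linear combination of elements with
  distinct valuations takes one of these valuations, so the \<open>g\<^sub>s\<close> are linearly independent modulo
  \<open>m I\<close>; and their span plus \<open>m I\<close> has all valuations of \<open>I\<close>, so it is \<open>I\<close>. Hence they form a basis of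
  \<open>I / m I\<close>, and \<open>S\<close> has \<open>k\<close> elements. By Nakayama's lemma (\<open>nakayama\<close>) they generate \<open>I\<close>. They are
  independent: an element of valuation \<open>s\<close> in the ideal of the other \<open>g\<close>'s would be, modulo \<open>m I\<close>, a
  linear combination of these, which again contradicts the independence of elements with valuations
  in \<open>S\<close>. Independence in turn implies that the generating set is minimal.

  Conversely, in a minimal set of generators with independent valuations no \<open>n\<^sub>i\<close> lies in \<open>val(m I)\<close>:
  an element of \<open>m I\<close> is \<open>a g\<^sub>i + x\<close> with \<open>a \<in> m\<close> and \<open>x\<close> in the ideal of the other generators, and if
  it has valuation \<open>n\<^sub>i\<close> then so does \<open>x\<close>. The \<open>n\<^sub>i\<close> are also pairwise distinct, so they are \<open>k\<close>
  elements of the \<open>k\<close>-element set \<open>S\<close>.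

  What remains is the identification of \<open>\<O>\<close> with \<open>A\<close>, that is, that \<open>h(p,q) = 0\<close> only for multiples
  \<open>h\<close> of \<open>f\<close> (\<open>subst2_eq_0_iff_dvd\<close>). By Weierstrass division the kernel of the substitution is
  principal, and an irreducible element of a proper principal ideal generates it.
\<close>

section \<open>Substitution as a ring homomorphism\<close>

lemma fps_power_nth_below:
  fixes q :: "'a::comm_ring_1 fps"
  assumes "q $ 0 = 0" "n < j"
  shows "(q ^ j) $ n = 0"
  using assms startsby_zero_power_prefix by blast

lemma mult_nth_below:
  fixes q g :: "'a::comm_ring_1 fps"
  assumes "q $ 0 = 0" "n < j"
  shows "(g * q ^ j) $ n = 0"
  using assms by (auto simp: fps_mult_nth fps_power_nth_below intro!: sum.neutral)

lemma subst2_nth: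
  assumes "q $ 0 = 0" "n \<le> M"
  shows "subst2 p q h $ n = (\<Sum>j\<le>M. (h $ j oo p) * q ^ j) $ n"
proof -
  have "(\<Sum>j\<le>n. ((h $ j oo p) * q ^ j) $ n) = (\<Sum>j\<le>M. ((h $ j oo p) * q ^ j) $ n)"
    by (rule sum.mono_neutral_left) (use assms in \<open>auto simp: mult_nth_below\<close>)
  then show ?thesis by (simp add: subst2_def fps_sum_nth)
qed

lemma subst2_add: "subst2 p q (g + h) = subst2 p q g + subst2 p q h"
  by (simp add: subst2_def fps_eq_iff fps_compose_add_distrib distrib_right sum.distrib)

lemma subst2_uminus: "subst2 p q (- h) = - subst2 p q h"
  by (simp add: subst2_def fps_eq_iff fps_compose_uminus sum_negf)

lemma subst2_diff: "subst2 p q (g - h) = subst2 p q g - subst2 p q h"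
  using subst2_add[of p q g "- h"] by (simp add: subst2_uminus)

lemma subst2_zero [simp]: "subst2 p q 0 = 0"
  by (simp add: subst2_def fps_eq_iff)

lemma subst2_nth_0: "subst2 p q h $ 0 = h $ 0 $ 0"
  by (simp add: subst2_def)

lemma subst2_const: "subst2 p q (fps_const h) = h oo p"
proof -
  have "(\<Sum>j\<le>n. ((fps_const h $ j oo p) * q ^ j) $ n) = (h oo p) $ n" for n
  proof -
    have "(\<Sum>j\<le>n. ((fps_const h $ j oo p) * q ^ j) $ n) =
      (\<Sum>j\<in>{0}. ((fps_const h $ j oo p) * q ^ j) $ n)"
      by (rule sum.mono_neutral_right) auto
    then show ?thesis by simp
  qed
  then show ?thesis by (simp add: subst2_def fps_eq_iff)
qed

lemma subst2_scalar: "subst2 p q (fps_const (fps_const c)) = fps_const c"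
  by (simp add: subst2_const)

lemma subst2_one [simp]: "subst2 p q 1 = 1"
  using subst2_scalar[of p q 1] by simp

text \<open>
  The algebra \<open>\<bbbK>[[p,q]]\<close> contains \<open>\<bbbK>[[q]]\<close> as well as
  \<open>\<bbbK>[[p]]\<close>, which is what is needed if it is \<open>q\<close> that is a power of \<open>t\<close>.
\<close>

lemma subst2_in_y:
  assumes "q $ 0 = 0"
  shows "subst2 p q (Abs_fps (\<lambda>j. fps_const (b $ j))) = b oo q"
  by (simp add: subst2_def fps_eq_iff fps_compose_nth atMost_atLeast0)

lemma subst2_mult:
  assumes p: "p $ 0 = 0" and q: "q $ 0 = 0"
  shows "subst2 p q (g * h) = subst2 p q g * subst2 p q h"
proof (rule fps_ext)
  fix n
  let ?g = "\<lambda>j. (g $ j oo p)" and ?h = "\<lambda>j. (h $ j oo p)"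
  have "(subst2 p q g * subst2 p q h) $ n =
      (\<Sum>i=0..n. (\<Sum>j\<le>n. ?g j * q ^ j) $ i * (\<Sum>j\<le>n. ?h j * q ^ j) $ (n - i))"
    unfolding fps_mult_nth by (rule sum.cong) (use q in \<open>auto simp: subst2_nth[where M = n]\<close>)
  also have "\<dots> = ((\<Sum>i\<le>n. ?g i * q ^ i) * (\<Sum>j\<le>n. ?h j * q ^ j)) $ n"
    by (simp add: fps_mult_nth)
  also have "\<dots> = (\<Sum>(i,j)\<in>{..n}\<times>{..n}. (?g i * ?h j) * q ^ (i + j)) $ n"
    by (simp add: sum_product sum.cartesian_product power_add mult_ac)
  also have "\<dots> = (\<Sum>(i,j)\<in>{..n}\<times>{..n}. ((?g i * ?h j) * q ^ (i + j)) $ n)"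
    by (simp add: fps_sum_nth case_prod_unfold)
  also have "\<dots> = (\<Sum>(i,j)\<in>{(i,j). i + j \<le> n}. ((?g i * ?h j) * q ^ (i + j)) $ n)"
    by (rule sum.mono_neutral_right) (use mult_nth_below[OF q] in \<open>auto simp: not_le[symmetric]\<close>)
  also have "\<dots> = (\<Sum>k\<le>n. \<Sum>i\<le>k. ((?g i * ?h (k - i)) * q ^ k) $ n)"
    by (subst sum.triangle_reindex_eq) simp
  also have "\<dots> = (\<Sum>k\<le>n. (((g * h) $ k oo p) * q ^ k) $ n)"
    by (rule sum.cong)
       (simp_all add: fps_mult_nth[of g h] fps_compose_sum_distrib fps_compose_mult_distrib[OF p]
         sum_distrib_right fps_sum_nth atMost_atLeast0)
  finally show "subst2 p q (g * h) $ n = (subst2 p q g * subst2 p q h) $ n"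
    by (simp add: subst2_def)
qed

section \<open>The kernel of the parameterization\<close>

lemma shift_mult_const:
  fixes c :: "'a::comm_ring_1 fps"
  shows "fps_shift d (fps_const c * g) = fps_const c * fps_shift d g"
  by (simp add: fps_eq_iff)

text \<open>
  Dividing by \<open>g = x \<cdot> low + y\<^sup>d v\<close> with \<open>v\<close> a unit. Only the coefficients of \<open>y\<^sup>j\<close>, \<open>j \<ge> d\<close>, matter, so the
  quotient \<open>u = z / v\<close> has to satisfy \<open>z + x \<cdot> T z = h0\<close>, where \<open>h0\<close> and \<open>T z\<close> are what is left of \<open>h\<close> and
  of \<open>z \<cdot> low / v\<close> after dropping the powers of \<open>y\<close> below \<open>d\<close>. Since \<open>T\<close> is linear over \<open>\<bbbK>[[x]]\<close>,
  the geometric series \<open>\<Sum>\<^sub>k (-x)\<^sup>k T\<^sup>k h0\<close> converges \<open>x\<close>-adically to a solution.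
\<close>

lemma weierstrass_division:
  fixes g h :: "'a::field fps fps"
  assumes g: "g $ d $ 0 \<noteq> 0" "\<And>j. j < d \<Longrightarrow> g $ j $ 0 = 0"
  obtains u where "\<And>j. j \<ge> d \<Longrightarrow> (h - u * g) $ j = 0"
proof -
  let ?x = "fps_const fps_X :: 'a fps fps"
  define v where "v = fps_shift d g"
  define low where "low = Abs_fps (\<lambda>j. if j < d then fps_shift 1 (g $ j) else 0)"
  have g_split: "g = ?x * low + fps_X ^ d * v"
  proof (rule fps_ext)
    fix j
    have "j < d \<Longrightarrow> g $ j = fps_X * fps_shift 1 (g $ j)"
      using g(2)[of j] by (intro fps_ext) (auto simp: fps_eq_iff)
    then show "g $ j = (?x * low + fps_X ^ d * v) $ j"
      by (auto simp: low_def v_def fps_X_power_mult_nth)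
  qed
  define w where "w = inverse (v $ 0)"
  have "v $ 0 * w = 1"
    using g(1) by (simp add: v_def w_def inverse_mult_eq_1')
  define vi where "vi = fps_right_inverse v w"
  have vi: "v * vi = 1"
    unfolding vi_def by (rule fps_right_inverse) (fact \<open>v $ 0 * w = 1\<close>)
  define T where "T z = fps_shift d (z * (low * vi))" for z
  have T_diff: "T (a - b) = T a - T b" for a b
    by (simp add: T_def algebra_simps fps_shift_diff)
  have T_add: "T (a + b) = T a + T b" for a b
    by (simp add: T_def algebra_simps fps_shift_add)
  have T_const: "T (fps_const c * a) = fps_const c * T a" for a c
    by (simp add: T_def mult.assoc shift_mult_const)
  define h0 where "h0 = fps_shift d h"
  define s where "s k = (- ?x) ^ k * (T ^^ k) h0" for k
  have mx: "(- ?x) ^ k = fps_const ((- fps_X) ^ k)" for k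
    by (simp add: fps_const_power[symmetric] fps_const_neg[symmetric] del: fps_const_power fps_const_neg)
  have s_Suc: "s (Suc k) = - (?x * T (s k))" for k
  proof -
    have "s (Suc k) = (- ?x) ^ Suc k * T ((T ^^ k) h0)" by (simp add: s_def)
    also have "\<dots> = - (?x * ((- ?x) ^ k * T ((T ^^ k) h0)))" by (simp only: power_Suc mult.assoc mult_minus_left)
    also have "(- ?x) ^ k * T ((T ^^ k) h0) = T (s k)" by (simp only: s_def mx T_const)
    finally show ?thesis .
  qed
  have s_low: "s k $ j $ i = 0" if "i < k" for i j k
  proof -
    have "s k $ j = fps_X ^ k * ((-1) ^ k * ((T ^^ k) h0 $ j))"
      by (simp add: s_def mx power_minus[of fps_X] mult_ac)
    then show ?thesis using that by (simp add: fps_X_power_mult_nth)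
  qed
  \<comment> \<open>The sum of the series: the term \<open>s k\<close> is divisible by \<open>x\<^sup>k\<close>, so it contributes only for \<open>k \<le> i\<close>.\<close>
  define z where "z = Abs_fps (\<lambda>j. Abs_fps (\<lambda>i. \<Sum>k\<le>i. s k $ j $ i))"
  have z_trunc: "(z - (\<Sum>k<N. s k)) $ j $ i = 0" if "i < N" for i j N
  proof -
    have "(\<Sum>k<N. s k $ j $ i) = (\<Sum>k\<le>i. s k $ j $ i)"
      by (rule sum.mono_neutral_right) (use that s_low in auto)
    then show ?thesis by (simp add: z_def fps_sum_nth)
  qed
  have T_low: "T a $ j $ i = 0" if "\<And>j i. i < N \<Longrightarrow> a $ j $ i = 0" "i < N" for a j i N
    using that by (simp add: T_def fps_mult_nth fps_sum_nth)
  have fin: "(\<Sum>k<N. s k) + ?x * T (\<Sum>k<N. s k) = h0 - s N" for N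
  proof (induction N)
    case 0
    then show ?case by (simp add: s_def T_def)
  next
    case (Suc N)
    then show ?case by (simp add: T_add distrib_left s_Suc) (simp add: algebra_simps)
  qed
  have fixpoint: "z + ?x * T z = h0"
  proof (intro fps_ext)
    fix j i
    define N where "N = Suc i"
    let ?S = "\<Sum>k<N. s k"
    have eq: "z + ?x * T z - h0 = (z - ?S) + ?x * T (z - ?S) - s N"
      using fin[of N] by (simp add: T_diff algebra_simps)
    have z0: "(z - ?S) $ j $ i = 0" by (rule z_trunc) (simp add: N_def)
    have T0: "T (z - ?S) $ j $ (i - 1) = 0"
      by (rule T_low[where N = N]) (use z_trunc in \<open>auto simp: N_def\<close>)
    have s0: "s N $ j $ i = 0" by (rule s_low) (simp add: N_def)
    have "((z - ?S) + ?x * T (z - ?S) - s N) $ j $ i = 0"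
      using T0 unfolding fps_sub_nth[of "_ + _"] fps_add_nth z0 s0 by simp
    then have "(z + ?x * T z - h0) $ j $ i = 0" by (simp only: eq)
    then show "(z + ?x * T z) $ j $ i = h0 $ j $ i" by simp
  qed
  define u where "u = z * vi"
  have "u * g = ?x * (z * (low * vi)) + fps_X ^ d * z * (v * vi)"
    unfolding u_def by (subst g_split) (simp only: algebra_simps)
  then have "fps_shift d (u * g) = ?x * T z + z"
    by (simp add: vi T_def fps_shift_add shift_mult_const mult.commute[of "fps_X ^ d"]
        fps_shift_times_fps_X_power)
  then have eq: "fps_shift d (u * g) = fps_shift d h"
    using fixpoint by (simp add: h0_def add.commute)
  have "(h - u * g) $ j = 0" if "j \<ge> d" for j
    using arg_cong[OF eq, of "\<lambda>a. a $ (j - d)"] that by simp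
  then show ?thesis by (rule that)
qed

text \<open>
  The last clause keeps the degree in \<open>y\<close> under control: if \<open>r\<close> is a remainder of Weierstrass division,
  then so is \<open>r'\<close>.
\<close>

lemma power_of_x_factor:
  fixes r :: "'a::field fps fps"
  assumes "r \<noteq> 0"
  obtains k r' j where "r = fps_const (fps_X ^ k) * r'" "r' $ j $ 0 \<noteq> 0"
    "\<And>j. r $ j = 0 \<Longrightarrow> r' $ j = 0"
proof -
  from assms obtain j1 where j1: "r $ j1 \<noteq> 0" by (auto simp: fps_eq_iff)
  define k where "k = (LEAST k. \<exists>j. r $ j \<noteq> 0 \<and> subdegree (r $ j) = k)"
  have "\<exists>j. r $ j \<noteq> 0 \<and> subdegree (r $ j) = k"
    unfolding k_def by (rule LeastI_ex) (use j1 in auto)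
  then obtain j where j: "r $ j \<noteq> 0" "subdegree (r $ j) = k" by auto
  have k_le: "k \<le> subdegree (r $ i)" if "r $ i \<noteq> 0" for i
    unfolding k_def by (rule Least_le) (use that in auto)
  define r' where "r' = Abs_fps (\<lambda>i. fps_shift k (r $ i))"
  have "r = fps_const (fps_X ^ k) * r'"
  proof (rule fps_ext)
    fix i
    show "r $ i = (fps_const (fps_X ^ k) * r') $ i"
      using fps_shift_times_fps_X_power[OF k_le[of i]]
      by (cases "r $ i = 0") (simp_all add: r'_def mult.commute)
  qed
  moreover have "r' $ j $ 0 \<noteq> 0" using j nth_subdegree_nonzero[of "r $ j"] by (simp add: r'_def)
  moreover have "r $ i = 0 \<Longrightarrow> r' $ i = 0" for i by (simp add: r'_def)
  ultimately show ?thesis using that by blast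
qed

text \<open>
  Once a proper ideal is known to be principal, every irreducible element of it is a generator. This
  is how \<open>f\<close> is compared with a generator of the kernel of the parameterization.
\<close>

lemma irreducible_associated:
  fixes f g :: "'a::comm_ring_1"
  assumes "Factorial_Ring.irreducible f" "g dvd f" "\<not> g dvd 1"
  shows "f dvd g"
proof -
  obtain c where c: "f = g * c" using assms(2) by (rule dvdE)
  then have "c dvd 1" using assms(1,3) irreducibleD by blast
  then obtain c' where c': "1 = c * c'" by (rule dvdE)
  have "g = f * c'" using c c' by (simp add: mult.assoc)
  then show ?thesis by (rule dvdI)
qed

lemma subst2_unit_not_zero:
  assumes "p $ 0 = 0" "q $ 0 = 0" "g dvd 1"
  shows "subst2 p q g \<noteq> 0"
proof
  assume "subst2 p q g = 0"
  moreover obtain c where "1 = g * c" using assms(3) by (rule dvdE)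
  ultimately have "subst2 p q 1 = 0" using subst2_mult[OF assms(1,2)] by (metis mult_zero_left)
  then show False by simp
qed

lemma x_dvd_iff:
  fixes g :: "'a::field fps fps"
  shows "fps_const fps_X dvd g \<longleftrightarrow> (\<forall>j. g $ j $ 0 = 0)"
proof
  assume "fps_const fps_X dvd g"
  then show "\<forall>j. g $ j $ 0 = 0" by (auto elim!: dvdE)
next
  assume *: "\<forall>j. g $ j $ 0 = 0"
  have "g = fps_const fps_X * Abs_fps (\<lambda>j. fps_shift 1 (g $ j))"
    using * by (auto simp: fps_eq_iff)
  then show "fps_const fps_X dvd g" by (metis dvd_triv_left)
qed

lemma x_not_unit: "\<not> (fps_const fps_X :: 'a::field fps fps) dvd 1"
proof
  assume "(fps_const fps_X :: 'a fps fps) dvd 1"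
  then have "(1 :: 'a fps fps) $ 0 $ 0 = 0" unfolding x_dvd_iff by blast
  then show False by simp
qed

lemma subst2_const_mult:
  assumes "p $ 0 = 0" "q $ 0 = 0"
  shows "subst2 p q (fps_const (fps_X ^ k) * r) = p ^ k * subst2 p q r"
  using assms by (simp add: subst2_mult subst2_const fps_X_power_compose)

text \<open>
  If \<open>p \<noteq> 0\<close>, take \<open>g\<close> in the kernel for which the order \<open>d\<close> of \<open>g(0,y)\<close> is least; it is finite for some
  \<open>g\<close> because otherwise \<open>f\<close> would be associated to \<open>x\<close>, whose value is \<open>p \<noteq> 0\<close>. The remainder of an element
  of the kernel on division by \<open>g\<close> is again in the kernel, and so is its quotient by the largest
  possible power of \<open>x\<close>, which would have a smaller order. So the remainder vanishes, the kernel is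
  generated by \<open>g\<close>, and \<open>f\<close> is associated to \<open>g\<close>. If \<open>p = 0\<close>, the kernel is generated by \<open>x\<close>.
\<close>

lemma subst2_eq_0_iff_dvd:
  assumes f: "Factorial_Ring.irreducible f" and root: "subst2 p q f = 0"
    and p: "p $ 0 = 0" and q: "q $ 0 = 0" and nz: "p \<noteq> 0 \<or> q \<noteq> 0"
  shows "subst2 p q h = 0 \<longleftrightarrow> f dvd h"
proof
  assume "f dvd h"
  then show "subst2 p q h = 0" using root by (auto simp: subst2_mult[OF p q] elim!: dvdE)
next
  assume h: "subst2 p q h = 0"
  show "f dvd h"
  proof (cases "p = 0")
    case True
    have x_dvd: "fps_const fps_X dvd g" if "subst2 p q g = 0" for g
    proof -
      have "subst2 p q g = Abs_fps (\<lambda>j. g $ j $ 0) oo q"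
        by (simp add: True subst2_def fps_eq_iff fps_compose_nth atMost_atLeast0)
      then have "Abs_fps (\<lambda>j. g $ j $ 0) oo q = 0" using that by simp
      moreover have "q \<noteq> 0" using nz True by simp
      ultimately have "Abs_fps (\<lambda>j. g $ j $ 0) = 0"
        using q by (simp add: fps_compose_eq_0_iff)
      then show ?thesis by (simp add: x_dvd_iff fps_eq_iff)
    qed
    show ?thesis
      using irreducible_associated[OF f x_dvd[OF root] x_not_unit] x_dvd[OF h] dvd_trans by blast
  next
    case False
    define D where "D = {d. \<exists>g. subst2 p q g = 0 \<and> g $ d $ 0 \<noteq> 0}"
    have "D \<noteq> {}"
    proof
      assume "D = {}"
      then have "fps_const fps_X dvd f" using root by (auto simp: D_def x_dvd_iff)
      then have "f dvd fps_const fps_X" using irreducible_associated f x_not_unit by blast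
      then obtain c where "fps_const fps_X = f * c" by (rule dvdE)
      then have "subst2 p q (fps_const fps_X) = 0" by (simp add: subst2_mult[OF p q] root)
      then show False using False p by (simp add: subst2_const)
    qed
    define d where "d = (LEAST d. d \<in> D)"
    have "d \<in> D" unfolding d_def using \<open>D \<noteq> {}\<close> by (auto intro: LeastI)
    then obtain g where g: "subst2 p q g = 0" "g $ d $ 0 \<noteq> 0" by (auto simp: D_def)
    have least: "g $ j $ 0 = 0" if "j < d" "subst2 p q g = 0" for j g
      using not_less_Least[of j "\<lambda>d. d \<in> D"] that by (auto simp: d_def D_def)
    have g_dvd: "g dvd a" if a: "subst2 p q a = 0" for a
    proof -
      obtain u where u: "\<And>j. j \<ge> d \<Longrightarrow> (a - u * g) $ j = 0"
        using weierstrass_division[OF g(2)] least[OF _ g(1)] by metis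
      define r where "r = a - u * g"
      have r0: "subst2 p q r = 0" using a g by (simp add: r_def subst2_diff subst2_mult[OF p q])
      have "r = 0"
      proof (rule ccontr)
        assume "r \<noteq> 0"
        then obtain k r' j where r': "r = fps_const (fps_X ^ k) * r'" "r' $ j $ 0 \<noteq> 0"
          "\<And>j. r $ j = 0 \<Longrightarrow> r' $ j = 0"
          using power_of_x_factor[OF \<open>r \<noteq> 0\<close>] by metis
        have "subst2 p q r' = 0"
          using r0 False unfolding r'(1) by (simp add: subst2_const_mult[OF p q])
        then have "j \<ge> d" using least r'(2) not_less by blast
        then have "r' $ j = 0" using r'(3) u by (simp add: r_def)
        then show False using r'(2) by simp
      qed
      then show ?thesis by (simp add: r_def)
    qed
    have "\<not> g dvd 1" using subst2_unit_not_zero[OF p q] g(1) by blast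
    then show ?thesis
      using irreducible_associated[OF f g_dvd[OF root]] g_dvd[OF h] dvd_trans by blast
  qed
qed

section \<open>Ideals of a subalgebra of power series and their valuations\<close>

definition vals :: "'a::zero fps set \<Rightarrow> nat set" where
  "vals J = subdegree ` (J - {0})"

lemma valsI: "x \<in> J \<Longrightarrow> x \<noteq> 0 \<Longrightarrow> subdegree x \<in> vals J"
  by (simp add: vals_def)

lemma valsE:
  assumes "v \<in> vals J"
  obtains x where "x \<in> J" "x \<noteq> 0" "subdegree x = v"
  using assms by (auto simp: vals_def)

lemma valsI_nth:
  assumes "x \<in> J" "x $ v \<noteq> 0" "\<forall>i<v. x $ i = 0"
  shows "v \<in> vals J"
proof -
  have "subdegree x = v" by (rule subdegreeI) (use assms in blast)+
  then show ?thesis using valsI[OF assms(1)] assms(2) by force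
qed

text \<open>
  The model is the image of a parameterization, with \<open>\<pi>\<close> one of its coordinates. Closure under
  \<open>b oo \<pi>\<close> says that \<open>A\<close> contains \<open>\<bbbK>[[\<pi>]]\<close>, over which \<open>\<bbbK>[[t]]\<close> is a finite module.
\<close>

locale series_algebra =
  fixes A :: "'a::field fps set" and \<pi> :: "'a fps"
  assumes const_closed: "fps_const c \<in> A"
    and add_closed: "a \<in> A \<Longrightarrow> b \<in> A \<Longrightarrow> a + b \<in> A"
    and mult_closed: "a \<in> A \<Longrightarrow> b \<in> A \<Longrightarrow> a * b \<in> A"
    and compose_closed: "b oo \<pi> \<in> A"
    and param_nonzero: "\<pi> \<noteq> 0"
    and param_nth_0: "\<pi> $ 0 = 0"
begin

definition is_ideal :: "'a fps set \<Rightarrow> bool" where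
  "is_ideal J \<longleftrightarrow> J \<subseteq> A \<and> 0 \<in> J \<and> (\<forall>x\<in>J. \<forall>y\<in>J. x + y \<in> J) \<and> (\<forall>a\<in>A. \<forall>x\<in>J. a * x \<in> J)"

definition span :: "'a fps set \<Rightarrow> 'a fps set" where
  "span G = \<Inter>{J. is_ideal J \<and> G \<subseteq> J}"

text \<open>
  The product of \<open>I\<close> with the maximal ideal \<open>{a \<in> A. a $ 0 = 0}\<close>.
\<close>

definition max_mult :: "'a fps set \<Rightarrow> 'a fps set" where
  "max_mult I = span {a * g | a g. a \<in> A \<and> a $ 0 = 0 \<and> g \<in> I}"

lemma zero_in: "0 \<in> A" and one_in: "1 \<in> A"
  using const_closed[of 0] const_closed[of 1] by simp_all

lemma is_idealI:
  assumes "J \<subseteq> A" "0 \<in> J" "\<And>x y. x \<in> J \<Longrightarrow> y \<in> J \<Longrightarrow> x + y \<in> J"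
    "\<And>a x. a \<in> A \<Longrightarrow> x \<in> J \<Longrightarrow> a * x \<in> J"
  shows "is_ideal J"
  using assms by (simp add: is_ideal_def)

context
  fixes J assumes J: "is_ideal J"
begin

lemma ideal_subset: "x \<in> J \<Longrightarrow> x \<in> A" and ideal_zero: "0 \<in> J"
  and ideal_add: "x \<in> J \<Longrightarrow> y \<in> J \<Longrightarrow> x + y \<in> J"
  and ideal_mult: "a \<in> A \<Longrightarrow> x \<in> J \<Longrightarrow> a * x \<in> J"
  using J by (auto simp: is_ideal_def)

lemma ideal_scale: "x \<in> J \<Longrightarrow> fps_const c * x \<in> J"
  using ideal_mult const_closed by blast

lemma ideal_uminus: "x \<in> J \<Longrightarrow> - x \<in> J"
  using ideal_scale[of x "-1"] by (simp flip: fps_const_neg)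

lemma ideal_diff: "x \<in> J \<Longrightarrow> y \<in> J \<Longrightarrow> x - y \<in> J"
  using ideal_add[of x "- y"] ideal_uminus[of y] by simp

lemma ideal_sum: "(\<And>i. i \<in> T \<Longrightarrow> u i \<in> J) \<Longrightarrow> (\<Sum>i\<in>T. u i) \<in> J"
  by (induction T rule: infinite_finite_induct) (auto simp: ideal_zero ideal_add)

end

lemma algebra_is_ideal: "is_ideal A"
  using zero_in add_closed mult_closed by (auto intro: is_idealI)

lemma span_superset: "G \<subseteq> span G"
  by (auto simp: span_def)

lemma span_minimal: "is_ideal J \<Longrightarrow> G \<subseteq> J \<Longrightarrow> span G \<subseteq> J"
  by (auto simp: span_def)

lemma span_ideal:
  assumes "G \<subseteq> A"
  shows "is_ideal (span G)"
proof (rule is_idealI)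
  show "span G \<subseteq> A" by (rule span_minimal[OF algebra_is_ideal assms])
qed (simp_all add: span_def ideal_zero ideal_add ideal_mult)

lemma span_mono: "G \<subseteq> H \<Longrightarrow> span G \<subseteq> span H"
  by (auto simp: span_def)

lemma max_mult_ideal: "is_ideal I \<Longrightarrow> is_ideal (max_mult I)"
  unfolding max_mult_def by (rule span_ideal) (use mult_closed ideal_subset in blast)

lemma max_mult_subset: "is_ideal I \<Longrightarrow> max_mult I \<subseteq> I"
  unfolding max_mult_def by (rule span_minimal) (use ideal_mult in blast)+

lemma max_mult_mem: "a \<in> A \<Longrightarrow> a $ 0 = 0 \<Longrightarrow> g \<in> I \<Longrightarrow> a * g \<in> max_mult I"
  unfolding max_mult_def by (rule subsetD[OF span_superset]) auto

text \<open>
  Bounds the tail of the series in \<open>ideal_eq_if_vals\<close>: the term \<open>b\<^sub>j \<pi>\<^sup>j g\<close> starts in degree at least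
  \<open>a + j \<cdot> subdegree \<pi>\<close>.
\<close>

lemma compose_mult_nth_below:
  assumes b: "\<And>j. a + subdegree \<pi> * j < v \<Longrightarrow> b $ j = 0"
    and g: "\<And>i. i < a \<Longrightarrow> g $ i = 0" and "i < v"
  shows "((b oo \<pi>) * g) $ i = 0"
proof -
  have "(b oo \<pi>) $ l * g $ (i - l) = 0" if "l \<le> i" for l
  proof (cases "i - l < a")
    case True
    then show ?thesis by (simp only: g mult_zero_right)
  next
    case False
    have "b $ j * (\<pi> ^ j) $ l = 0" for j
    proof (cases "l < subdegree \<pi> * j")
      case True
      then have "l < subdegree (\<pi> ^ j)" by (simp add: mult.commute)
      then show ?thesis by (simp only: nth_less_subdegree_zero mult_zero_right)
    next
      case j: False
      then have "a + subdegree \<pi> * j < v" using False that \<open>i < v\<close> by simp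
      then show ?thesis by (simp only: b mult_zero_left)
    qed
    then have "(b oo \<pi>) $ l = 0" unfolding fps_compose_nth by (intro sum.neutral ballI)
    then show ?thesis by simp
  qed
  then show ?thesis unfolding fps_mult_nth by (intro sum.neutral ballI) simp
qed

text \<open>
  For each residue \<open>r\<close> modulo \<open>e = subdegree \<pi>\<close>, let \<open>G r \<in> J\<close> have the least valuation \<open>a r\<close> congruent to
  \<open>r\<close>. Each valuation \<open>w\<close> of \<open>J\<close> is then attained by some \<open>M w = \<pi>\<^sup>j G (w mod e)\<close>, and subtracting
  multiples \<open>c w \<cdot> M w\<close> from \<open>h\<close> yields a sequence \<open>H w \<in> I\<close> that tends to \<open>0\<close>. The sum of all that has been
  subtracted lies in \<open>J\<close>: collecting the terms with \<open>w mod e = r\<close> gives a power series in \<open>\<pi>\<close> times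
  \<open>G r\<close>.
\<close>

theorem ideal_eq_if_vals:
  assumes I: "is_ideal I" and J: "is_ideal J" and "J \<subseteq> I" and vals: "vals I \<subseteq> vals J"
  shows "I = J"
proof (intro equalityI subsetI)
  fix h assume h: "h \<in> I"
  define e where "e = subdegree \<pi>"
  have e: "e > 0" using param_nonzero param_nth_0 subdegree_eq_0_iff[of \<pi>] by (simp add: e_def)
  define P where "P r g \<longleftrightarrow> g \<in> J \<and> g \<noteq> 0 \<and> subdegree g mod e = r" for r g
  define G where "G r = (if \<exists>g. P r g then (ARG_MIN subdegree g. P r g) else 0)" for r
  define a where "a r = subdegree (G r)" for r
  have G: "P r (G r) \<and> a r \<le> subdegree g" if "P r g" for r g
    using arg_min_nat_lemma[of "P r" g subdegree] that by (auto simp: G_def a_def)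
  have GJ: "G r \<in> J" for r
    using G[of r] ideal_zero[OF J] by (cases "\<exists>g. P r g") (auto simp: P_def G_def)
  \<comment> \<open>Meaningful for \<open>w \<in> vals J\<close>; for other \<open>w\<close> the coefficient \<open>c w\<close> vanishes.\<close>
  define M where "M w = \<pi> ^ ((w - a (w mod e)) div e) * G (w mod e)" for w
  define C where "C w H = (if H $ w = 0 then 0 else H $ w / M w $ w)" for w and H :: "'a fps"
  define H where "H = rec_nat h (\<lambda>w H. H - fps_const (C w H) * M w)"
  define c where "c w = C w (H w)" for w
  have H0: "H 0 = h" and H_Suc: "H (Suc w) = H w - fps_const (c w) * M w" for w
    by (simp_all add: H_def c_def)
  have MJ: "M w \<in> J" for w
    unfolding M_def using compose_closed[of "fps_X ^ _"] param_nth_0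
    by (auto intro!: ideal_mult[OF J] GJ simp: fps_X_power_compose)
  have M: "M w \<noteq> 0 \<and> subdegree (M w) = w \<and> a (w mod e) \<le> w \<and> e dvd w - a (w mod e)
      \<and> G (w mod e) \<noteq> 0" if w: "w \<in> vals I" for w
  proof -
    obtain g where g: "g \<in> J" "g \<noteq> 0" "subdegree g = w" using subsetD[OF vals w] by (auto simp: vals_def)
    then have "P (w mod e) g" by (simp add: P_def)
    from G[OF this] have G': "P (w mod e) (G (w mod e))" "a (w mod e) \<le> w" by (auto simp: g)
    then have "a (w mod e) mod e = w mod e" by (simp add: P_def a_def)
    then have dvd: "e dvd w - a (w mod e)" using G'(2) by (metis mod_eq_dvd_iff_nat)
    have nz: "G (w mod e) \<noteq> 0" using G'(1) by (simp add: P_def)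
    have "subdegree (M w) = (w - a (w mod e)) div e * e + a (w mod e)"
      unfolding M_def using nz param_nonzero by (simp add: e_def a_def subdegree_power)
    also have "\<dots> = w" using dvd G'(2) by simp
    finally show ?thesis using nz param_nonzero dvd G'(2) by (simp add: M_def)
  qed
  have inv: "H v \<in> I \<and> (\<forall>i<v. H v $ i = 0)" for v
  proof (induction v)
    case 0
    then show ?case by (simp add: H0 h)
  next
    case (Suc w)
    have "H (Suc w) \<in> I"
      unfolding H_Suc using Suc MJ \<open>J \<subseteq> I\<close> by (auto intro!: ideal_diff[OF I] ideal_scale[OF I])
    moreover have "H (Suc w) $ i = 0" if "i < Suc w" for i
    proof (cases "H w $ w = 0")
      case True
      then have "c w = 0" by (simp add: c_def C_def)
      then show ?thesis using Suc that True by (auto simp: H_Suc less_Suc_eq)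
    next
      case False
      then have "w \<in> vals I" using Suc by (intro valsI_nth[of "H w"]) auto
      from M[OF this] have M': "M w \<noteq> 0" "subdegree (M w) = w" by auto
      then have nz: "M w $ w \<noteq> 0" using nth_subdegree_nonzero by metis
      show ?thesis
      proof (cases "i = w")
        case True
        then show ?thesis using nz False by (simp add: H_Suc c_def C_def)
      next
        case False
        then have i: "i < w" using that by simp
        then have "M w $ i = 0" using M'(2) nth_less_subdegree_zero[of i "M w"] by simp
        then show ?thesis using Suc i by (simp add: H_Suc)
      qed
    qed
    ultimately show ?case by blast
  qed
  have c_vals: "w \<in> vals I" if "c w \<noteq> 0" for w
  proof -
    have "H w $ w \<noteq> 0"
    proof
      assume "H w $ w = 0"
      then show False using that by (simp add: c_def C_def)
    qed
    then show ?thesis using inv[of w] by (intro valsI_nth[of "H w"]) auto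
  qed
  \<comment> \<open>\<open>B v\<close> is the sum of the terms \<open>c w \<cdot> M w\<close> with \<open>w \<ge> v\<close>, so that \<open>H v - B v\<close> does not depend on \<open>v\<close>.\<close>
  define b where "b v r = Abs_fps (\<lambda>j. if a r + e * j < v then 0 else c (a r + e * j))" for v r
  define B where "B v = (\<Sum>r<e. (b v r oo \<pi>) * G r)" for v
  have B_Suc: "B (Suc w) = B w - fps_const (c w) * M w" for w
  proof (cases "c w = 0")
    case True
    then have "(if n < Suc w then 0 else c n) = (if n < w then 0 else c n)" for n
      by (cases "n = w") auto
    then have "b (Suc w) r = b w r" for r by (simp add: b_def)
    then show ?thesis by (simp add: B_def True)
  next
    case False
    define r where "r = w mod e"
    define j where "j = (w - a r) div e"
    have r: "r < e" using e by (simp add: r_def)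
    have M': "a r \<le> w" "e dvd w - a r" "G r \<noteq> 0" using M[OF c_vals[OF False]] by (auto simp: r_def)
    have w: "w = a r + e * j" using M' by (simp add: j_def)
    have other: "(b (Suc w) r' oo \<pi>) * G r' = (b w r' oo \<pi>) * G r'" if "r' < e" "r' \<noteq> r" for r'
    proof (cases "G r' = 0")
      case False
      then obtain g where "P r' g" by (auto simp: G_def split: if_splits)
      then have "P r' (G r')" using G by blast
      then have "a r' mod e = r'" by (simp add: P_def a_def)
      then have "(a r' + e * i) mod e = r'" for i by simp
      then have "a r' + e * i \<noteq> w" for i using that(2) r_def by metis
      then have "(a r' + e * i < Suc w) = (a r' + e * i < w)" for i by (simp add: less_Suc_eq)
      then have "b (Suc w) r' = b w r'" by (simp add: b_def)
      then show ?thesis by simp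
    qed simp
    have "b (Suc w) r = b w r - fps_const (c w) * fps_X ^ j"
    proof (rule fps_ext)
      fix i
      consider "i < j" | "i = j" | "i > j" by linarith
      then show "b (Suc w) r $ i = (b w r - fps_const (c w) * fps_X ^ j) $ i"
      proof cases
        case 1
        then have "a r + e * i < w" using e unfolding w by simp
        then show ?thesis using 1 by (simp add: b_def)
      next
        case 2
        then have "a r + e * i = w" using w by simp
        then show ?thesis using 2 by (simp add: b_def)
      next
        case 3
        then have "\<not> a r + e * i < Suc w" using e unfolding w by (simp add: not_less Suc_le_eq)
        then show ?thesis using 3 by (simp add: b_def)
      qed
    qed
    then have "b (Suc w) r oo \<pi> = (b w r oo \<pi>) - fps_const (c w) * \<pi> ^ j"
      by (simp add: fps_compose_sub_distrib fps_compose_mult_distrib param_nth_0 fps_X_power_compose)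
    then have at_r: "(b (Suc w) r oo \<pi>) * G r = (b w r oo \<pi>) * G r - fps_const (c w) * M w"
      unfolding M_def r_def[symmetric] j_def[symmetric] by (simp only: left_diff_distrib mult.assoc)
    have split: "B v = (b v r oo \<pi>) * G r + (\<Sum>r'\<in>{..<e}-{r}. (b v r' oo \<pi>) * G r')" for v
      unfolding B_def by (rule sum.remove) (use r in auto)
    have "(\<Sum>r'\<in>{..<e}-{r}. (b (Suc w) r' oo \<pi>) * G r') =
        (\<Sum>r'\<in>{..<e}-{r}. (b w r' oo \<pi>) * G r')"
      by (rule sum.cong) (use other in auto)
    then show ?thesis unfolding split[of w] split[of "Suc w"] at_r by simp
  qed
  have B_low: "B v $ i = 0" if "i < v" for i v
    unfolding B_def fps_sum_nth
  proof (rule sum.neutral, rule ballI)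
    fix r
    show "((b v r oo \<pi>) * G r) $ i = 0"
    proof (rule compose_mult_nth_below)
      show "b v r $ j = 0" if "a r + subdegree \<pi> * j < v" for j
        using that by (simp add: b_def e_def)
      show "G r $ l = 0" if "l < a r" for l
        using that nth_less_subdegree_zero[of l "G r"] by (simp add: a_def)
    qed (fact that)
  qed
  have diff: "H v - B v = h - B 0" for v
    by (induction v) (simp_all add: H0 H_Suc B_Suc)
  have "(h - B 0) $ i = 0" for i
    using inv[of "Suc i"] B_low[of i "Suc i"] unfolding diff[of "Suc i", symmetric] by simp
  then have "h = B 0" by (simp add: fps_eq_iff)
  moreover have "B 0 \<in> J"
    unfolding B_def by (intro ideal_sum[OF J] ideal_mult[OF J] compose_closed GJ)
  ultimately show "h \<in> J" by simp
qed (use \<open>J \<subseteq> I\<close> in auto)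

end

text \<open>
  The least of the distinct valuations that enter with a nonzero coefficient cannot be cancelled.
\<close>

lemma subdegree_linear_combination:
  fixes u :: "'i \<Rightarrow> 'a::field fps"
  assumes T: "finite T" and nz: "\<And>i. i \<in> T \<Longrightarrow> u i \<noteq> 0"
    and inj: "inj_on (\<lambda>i. subdegree (u i)) T" and c: "i \<in> T" "c i \<noteq> 0"
  shows "(\<Sum>i\<in>T. fps_const (c i) * u i) \<noteq> 0 \<and>
    subdegree (\<Sum>i\<in>T. fps_const (c i) * u i) \<in> (\<lambda>i. subdegree (u i)) ` T"
proof -
  define Q where "Q i \<longleftrightarrow> i \<in> T \<and> c i \<noteq> 0" for i
  have Qi: "Q i" using c by (simp add: Q_def)
  define i0 where "i0 = (ARG_MIN (\<lambda>i. subdegree (u i)) i. Q i)"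
  have i0: "i0 \<in> T" "c i0 \<noteq> 0"
    and min: "\<And>l. l \<in> T \<Longrightarrow> c l \<noteq> 0 \<Longrightarrow> subdegree (u i0) \<le> subdegree (u l)"
    using arg_min_nat_lemma[of Q i "\<lambda>i. subdegree (u i)", OF Qi]
    by (simp_all add: i0_def[symmetric] Q_def)
  define n where "n = subdegree (u i0)"
  let ?s = "\<Sum>i\<in>T. fps_const (c i) * u i"
  have low: "c i * u i $ l = 0" if "i \<in> T" "l \<le> n" "i \<noteq> i0 \<or> l < n" for i l
  proof (cases "c i = 0")
    case False
    have "subdegree (u i0) \<le> subdegree (u i)" by (rule min[OF that(1) False])
    moreover have "subdegree (u i0) \<noteq> subdegree (u i)" if "i \<noteq> i0"
      using inj_onD[OF inj _ \<open>i \<in> T\<close> i0(1)] that by auto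
    ultimately have "l < subdegree (u i)" using that(2,3) by (auto simp: n_def)
    then show ?thesis using nth_less_subdegree_zero[of l "u i"] by simp
  qed simp
  have "?s $ n = (\<Sum>i\<in>T. c i * u i $ n)" by (simp add: fps_sum_nth)
  also have "\<dots> = (\<Sum>i\<in>{i0}. c i * u i $ n)"
    by (rule sum.mono_neutral_right) (use T i0 low in auto)
  finally have "?s $ n = c i0 * u i0 $ n" by simp
  moreover have "u i0 $ n \<noteq> 0" using nz i0 by (simp add: n_def)
  ultimately have s: "?s $ n \<noteq> 0" using i0 by simp
  moreover have "?s $ l = 0" if "l < n" for l
    using low that by (auto simp: fps_sum_nth intro!: sum.neutral)
  ultimately have "subdegree ?s = n" by (intro subdegreeI) auto
  then show ?thesis using s i0 by (auto simp: n_def)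
qed

section \<open>Independent valuations\<close>

context series_algebra
begin

text \<open>
  The images in \<open>A\<close> of the corresponding notions for \<open>\<O>\<close>.
\<close>

definition minimal_gens :: "'a fps set \<Rightarrow> 'a fps list \<Rightarrow> bool" where
  "minimal_gens I gs \<longleftrightarrow> distinct gs \<and> set gs \<subseteq> A \<and> span (set gs) = I \<and>
     (\<forall>S. S \<subset> set gs \<longrightarrow> span S \<noteq> I)"

definition independent_vals :: "'a fps list \<Rightarrow> bool" where
  "independent_vals gs \<longleftrightarrow> sorted (map subdegree gs) \<and>
     (\<forall>i<length gs. subdegree (gs ! i) \<notin> vals (span ((!) gs ` ({..<length gs} - {i}))))"

definition independent_mod :: "'a fps set \<Rightarrow> nat \<Rightarrow> (nat \<Rightarrow> 'a fps) \<Rightarrow> bool" where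
  "independent_mod N m u \<longleftrightarrow>
     (\<forall>c. (\<Sum>i<m. fps_const (c i) * u i) \<in> N \<longrightarrow> (\<forall>i<m. c i = 0))"

text \<open>
  Closed under multiplication by \<open>A\<close> because \<open>a \<in> A\<close> acts on \<open>I / m I\<close> through its constant term.
\<close>

lemma linear_span_ideal:
  assumes I: "is_ideal I" and T: "finite T" and u: "\<And>i. i \<in> T \<Longrightarrow> u i \<in> I"
  shows "is_ideal {(\<Sum>i\<in>T. fps_const (c i) * u i) + n | c n. n \<in> max_mult I}" (is "is_ideal ?L")
proof (rule is_idealI)
  note N = max_mult_ideal[OF I]
  have s: "(\<Sum>i\<in>T. fps_const (c i) * u i) \<in> I" for c
    by (rule ideal_sum[OF I]) (use u ideal_scale[OF I] in auto)
  show "?L \<subseteq> A"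
  proof
    fix x assume "x \<in> ?L"
    then obtain c n where x: "x = (\<Sum>i\<in>T. fps_const (c i) * u i) + n" "n \<in> max_mult I" by blast
    show "x \<in> A"
      unfolding x(1) by (rule ideal_subset[OF I], rule ideal_add[OF I s])
        (use x(2) max_mult_subset[OF I] in auto)
  qed
  show "0 \<in> ?L"
    using ideal_zero[OF N] by (intro CollectI exI[of _ "\<lambda>_. 0"] exI[of _ 0]) auto
  show "x + y \<in> ?L" if xy: "x \<in> ?L" "y \<in> ?L" for x y
  proof -
    obtain c n d n' where "x = (\<Sum>i\<in>T. fps_const (c i) * u i) + n" "n \<in> max_mult I"
      "y = (\<Sum>i\<in>T. fps_const (d i) * u i) + n'" "n' \<in> max_mult I" using xy by blast
    then show ?thesis
      using ideal_add[OF N]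
      by (intro CollectI exI[of _ "\<lambda>i. c i + d i"] exI[of _ "n + n'"])
         (simp add: fps_const_add[symmetric] distrib_right sum.distrib del: fps_const_add)
  qed
  show "a * x \<in> ?L" if a: "a \<in> A" and x: "x \<in> ?L" for a x
  proof -
    obtain c n where x: "x = (\<Sum>i\<in>T. fps_const (c i) * u i) + n" "n \<in> max_mult I"
      using x by blast
    define s where "s = (\<Sum>i\<in>T. fps_const (c i) * u i)"
    have "a - fps_const (a $ 0) \<in> A" by (rule ideal_diff[OF algebra_is_ideal a const_closed])
    then have "(a - fps_const (a $ 0)) * s \<in> max_mult I"
      by (rule max_mult_mem) (simp_all add: s_def s)
    then have "(a - fps_const (a $ 0)) * s + a * n \<in> max_mult I"
      by (rule ideal_add[OF N]) (rule ideal_mult[OF N a x(2)])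
    moreover have "a * x = (\<Sum>i\<in>T. fps_const (a $ 0 * c i) * u i) +
        ((a - fps_const (a $ 0)) * s + a * n)"
    proof -
      have "(\<Sum>i\<in>T. fps_const (a $ 0 * c i) * u i) = fps_const (a $ 0) * s"
        by (simp add: s_def sum_distrib_left fps_const_mult[symmetric] mult.assoc del: fps_const_mult)
      then show ?thesis unfolding x(1) s_def[symmetric] by (simp add: algebra_simps)
    qed
    ultimately show ?thesis
      by (intro CollectI exI[of _ "\<lambda>i. a $ 0 * c i"] exI[of _ "(a - fps_const (a $ 0)) * s + a * n"] conjI)
  qed
qed

lemma linear_span_contains:
  fixes u :: "'i \<Rightarrow> 'a fps"
  assumes T: "finite T" "i \<in> T" and N: "0 \<in> N"
  shows "u i \<in> {(\<Sum>i\<in>T. fps_const (c i) * u i) + n | c n. n \<in> N}"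
proof -
  have "(\<Sum>l\<in>T. fps_const (if l = i then 1 else 0) * u l) = (\<Sum>l\<in>T. if l = i then u l else 0)"
    by (rule sum.cong) auto
  then have "(\<Sum>l\<in>T. fps_const (if l = i then 1 else 0) * u l) = u i"
    using T by (simp add: sum.delta)
  then show ?thesis using N by (intro CollectI exI[of _ "\<lambda>l. if l = i then 1 else 0"] exI[of _ 0]) simp
qed

lemma independent_mod_if_vals:
  assumes "\<And>i. i < m \<Longrightarrow> u i \<noteq> 0" "inj_on (\<lambda>i. subdegree (u i)) {..<m}"
    "\<And>i. i < m \<Longrightarrow> subdegree (u i) \<notin> vals N"
  shows "independent_mod N m u"
  unfolding independent_mod_def
proof (intro allI impI, rule ccontr)
  fix c i
  let ?s = "\<Sum>i<m. fps_const (c i) * u i"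
  assume "?s \<in> N" "i < m" "c i \<noteq> 0"
  then have "?s \<noteq> 0 \<and> subdegree ?s \<in> (\<lambda>i. subdegree (u i)) ` {..<m}"
    using assms by (intro subdegree_linear_combination[of _ _ i]) auto
  moreover from this have "subdegree ?s \<in> vals N" using \<open>?s \<in> N\<close> by (intro valsI) auto
  ultimately show False using assms(3) by auto
qed

text \<open>
  An element of \<open>I\<close> lies in this ideal iff \<open>J\<close> approximates it up to order \<open>v\<close>; being an ideal, it
  contains \<open>m I\<close> as soon as it contains the products that generate \<open>m I\<close>.
\<close>

lemma mod_order_ideal:
  assumes I: "is_ideal I" and J: "is_ideal J" and "J \<subseteq> I"
  shows "is_ideal {j + x | j x. j \<in> J \<and> x \<in> I \<and> (\<forall>i<v. x $ i = 0)}" (is "is_ideal ?L")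
proof (rule is_idealI)
  show "?L \<subseteq> A"
    using ideal_subset[OF I] ideal_add[OF I] \<open>J \<subseteq> I\<close> by blast
  show "0 \<in> ?L"
    using ideal_zero[OF I] ideal_zero[OF J] by (intro CollectI exI[of _ 0]) auto
  show "x + y \<in> ?L" if xy: "x \<in> ?L" "y \<in> ?L" for x y
  proof -
    obtain j x' j' y' where "x = j + x'" "y = j' + y'" "j \<in> J" "j' \<in> J" "x' \<in> I" "y' \<in> I"
      "\<forall>i<v. x' $ i = 0" "\<forall>i<v. y' $ i = 0" using xy by blast
    then show ?thesis
      using ideal_add[OF I] ideal_add[OF J]
      by (intro CollectI exI[of _ "j + j'"] exI[of _ "x' + y'"]) simp
  qed
  show "a * x \<in> ?L" if a: "a \<in> A" and x: "x \<in> ?L" for a x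
  proof -
    obtain j x' where x: "x = j + x'" "j \<in> J" "x' \<in> I" "\<forall>i<v. x' $ i = 0" using x by blast
    have "\<forall>i<v. (a * x') $ i = 0" using x(4) by (auto simp: fps_mult_nth intro!: sum.neutral)
    then show ?thesis
      using ideal_mult[OF I a] ideal_mult[OF J a] x
      by (intro CollectI exI[of _ "a * j"] exI[of _ "a * x'"]) (simp add: distrib_left)
  qed
qed

text \<open>
  The hypothesis says \<open>I = J + m I\<close>, so that by induction on \<open>v\<close> every element of \<open>I\<close> is congruent
  modulo \<open>t\<^sup>v\<close> to an element of \<open>J\<close>: multiplication by \<open>m\<close> improves the congruence by one. With \<open>v\<close> larger
  than its valuation, \<open>J\<close> is seen to have all the valuations of \<open>I\<close>.
\<close>

lemma nakayama:
  assumes I: "is_ideal I" and J: "is_ideal J" and "J \<subseteq> I"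
    and gen: "\<And>K. is_ideal K \<Longrightarrow> J \<subseteq> K \<Longrightarrow> max_mult I \<subseteq> K \<Longrightarrow> I \<subseteq> K"
  shows "I = J"
proof (rule ideal_eq_if_vals[OF I J \<open>J \<subseteq> I\<close>])
  define L where "L v = {j + x | j x. j \<in> J \<and> x \<in> I \<and> (\<forall>i<v. x $ i = 0)}" for v
  have L: "is_ideal (L v)" for v unfolding L_def by (rule mod_order_ideal[OF I J \<open>J \<subseteq> I\<close>])
  have JL: "J \<subseteq> L v" for v
    unfolding L_def using ideal_zero[OF I] by (force intro: exI[of _ 0])
  have "I \<subseteq> L v" for v
  proof (induction v)
    case 0
    have "0 + x \<in> L 0" if "x \<in> I" for x
      unfolding L_def using that ideal_zero[OF J] by blast
    then show ?case by auto
  next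
    case (Suc v)
    have "max_mult I \<subseteq> L (Suc v)"
      unfolding max_mult_def
    proof (rule span_minimal[OF L], rule subsetI)
      fix y assume "y \<in> {a * g | a g. a \<in> A \<and> a $ 0 = 0 \<and> g \<in> I}"
      then obtain a g where y: "y = a * g" "a \<in> A" "a $ 0 = 0" "g \<in> I" by blast
      then have "g \<in> L v" using Suc by blast
      then obtain j x where g: "g = j + x" "j \<in> J" "x \<in> I" "\<forall>i<v. x $ i = 0"
        unfolding L_def by blast
      have "(a * x) $ i = 0" if "i < Suc v" for i
        unfolding fps_mult_nth
      proof (intro sum.neutral ballI)
        fix l assume "l \<in> {0..i}"
        then show "a $ l * x $ (i - l) = 0" using g(4) y(3) that by (cases "l = 0") auto
      qed
      then have "a * j + a * x \<in> L (Suc v)"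
        unfolding L_def using ideal_mult[OF J y(2) g(2)] ideal_mult[OF I y(2) g(3)] by blast
      then show "y \<in> L (Suc v)" by (simp add: y g distrib_left)
    qed
    then show ?case by (rule gen[OF L JL])
  qed
  then have IL: "h \<in> I \<Longrightarrow> h \<in> L v" for h v by blast
  show "vals I \<subseteq> vals J"
  proof
    fix v assume "v \<in> vals I"
    then obtain h where h: "h \<in> I" "h \<noteq> 0" "subdegree h = v" by (rule valsE)
    obtain j x where jx: "h = j + x" "j \<in> J" "\<forall>i<Suc v. x $ i = 0"
      using IL[OF h(1), of "Suc v"] unfolding L_def by blast
    have "h $ i = j $ i" if "i < Suc v" for i using jx that by simp
    moreover have "h $ v \<noteq> 0" using h nth_subdegree_nonzero by blast
    moreover have "h $ i = 0" if "i < v" for i using h nth_less_subdegree_zero that by blast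
    ultimately show "v \<in> vals J" by (intro valsI_nth[OF jx(2)]) auto
  qed
qed

lemma not_redundant:
  assumes "minimal_gens I gs" "i < length gs"
  shows "gs ! i \<notin> span ((!) gs ` ({..<length gs} - {i}))"
proof
  let ?G = "(!) gs ` ({..<length gs} - {i})"
  assume mem: "gs ! i \<in> span ?G"
  have gs: "distinct gs" "set gs \<subseteq> A" "span (set gs) = I"
    "\<And>S. S \<subset> set gs \<Longrightarrow> span S \<noteq> I" using assms(1) by (auto simp: minimal_gens_def)
  have set_gs: "set gs = insert (gs ! i) ?G"
    using assms(2) by (auto simp: in_set_conv_nth)
  have "gs ! i \<notin> ?G" using gs(1) assms(2) by (auto simp: nth_eq_iff_index_eq)
  then have "?G \<subset> set gs" using set_gs by blast
  moreover have "span ?G = I"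
  proof
    show "span ?G \<subseteq> I" using span_mono[of ?G "set gs"] gs(3) set_gs by blast
    have "set gs \<subseteq> span ?G" using set_gs mem span_superset[of ?G] by auto
    moreover have "?G \<subseteq> A" using gs(2) set_gs by blast
    ultimately show "I \<subseteq> span ?G" unfolding gs(3)[symmetric]
      by (intro span_minimal span_ideal)
  qed
  ultimately show False using gs(4) by blast
qed

text \<open>
  Both inclusions \<open>I \<subseteq> A g + (G)\<close> and \<open>m I \<subseteq> m g + (G)\<close>, for \<open>I = (g, G)\<close>, are instances of the same fact:
  \<open>B g + (G)\<close> is an ideal for each ideal \<open>B\<close>.
\<close>

lemma max_mult_span_insert:
  assumes "g \<in> A" "G \<subseteq> A"
  shows "max_mult (span (insert g G)) \<subseteq> {a * g + x | a x. a \<in> A \<and> a $ 0 = 0 \<and> x \<in> span G}"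
proof -
  note G = span_ideal[OF assms(2)]
  have ideal: "is_ideal {a * g + x | a x. a \<in> B \<and> x \<in> span G}"
    if B: "is_ideal B" for B
  proof (rule is_idealI)
    show "{a * g + x | a x. a \<in> B \<and> x \<in> span G} \<subseteq> A" (is "?L \<subseteq> A")
      using ideal_subset[OF B] ideal_subset[OF G] add_closed mult_closed assms(1) by blast
    have "0 * g + 0 \<in> ?L" using ideal_zero[OF B] ideal_zero[OF G] by blast
    then show "0 \<in> ?L" by simp
    show "x + y \<in> ?L" if xy: "x \<in> ?L" "y \<in> ?L" for x y
    proof -
      obtain a x' b y' where *: "x = a * g + x'" "y = b * g + y'" "a \<in> B" "b \<in> B"
        "x' \<in> span G" "y' \<in> span G" using xy by blast
      then have "(a + b) * g + (x' + y') \<in> ?L" using ideal_add[OF B] ideal_add[OF G] by blast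
      then show ?thesis by (simp add: * algebra_simps)
    qed
    show "c * x \<in> ?L" if c: "c \<in> A" and x: "x \<in> ?L" for c x
    proof -
      obtain a x' where *: "x = a * g + x'" "a \<in> B" "x' \<in> span G" using x by blast
      then have "(c * a) * g + c * x' \<in> ?L" using ideal_mult[OF B c] ideal_mult[OF G c] by blast
      then show ?thesis by (simp add: * algebra_simps)
    qed
  qed
  define m where "m = {a \<in> A. a $ 0 = 0}"
  have m: "is_ideal m"
    by (rule is_idealI) (auto simp: m_def zero_in add_closed mult_closed)
  have "insert g G \<subseteq> {a * g + x | a x. a \<in> A \<and> x \<in> span G}" (is "_ \<subseteq> ?K")
  proof
    fix y assume "y \<in> insert g G"
    then consider "y = g" | "y \<in> G" by blast
    then show "y \<in> ?K"
    proof cases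
      case 1
      have "1 * g + 0 \<in> ?K" using one_in ideal_zero[OF G] by blast
      then show ?thesis using 1 by simp
    next
      case 2
      have "0 * g + y \<in> ?K" using zero_in 2 span_superset[of G] by blast
      then show ?thesis by simp
    qed
  qed
  then have span: "span (insert g G) \<subseteq> ?K" by (rule span_minimal[OF ideal[OF algebra_is_ideal]])
  have "max_mult (span (insert g G)) \<subseteq> {a * g + x | a x. a \<in> m \<and> x \<in> span G}" (is "_ \<subseteq> ?M")
    unfolding max_mult_def
  proof (rule span_minimal[OF ideal[OF m]], rule subsetI)
    fix y assume "y \<in> {a * h | a h. a \<in> A \<and> a $ 0 = 0 \<and> h \<in> span (insert g G)}"
    then obtain a h where y: "y = a * h" "a \<in> A" "a $ 0 = 0" "h \<in> span (insert g G)" by blast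
    then obtain b x where h: "h = b * g + x" "b \<in> A" "x \<in> span G" using span by blast
    have "a * b \<in> m" using y h mult_closed by (simp add: m_def)
    moreover have "a * x \<in> span G" by (rule ideal_mult[OF G y(2) h(3)])
    ultimately have "(a * b) * g + a * x \<in> ?M" by blast
    then show "y \<in> ?M" by (simp add: y h algebra_simps)
  qed
  then show ?thesis by (simp add: m_def conj_assoc)
qed

text \<open>
  If \<open>a g\<^sub>i + x \<in> m I\<close> had the valuation of \<open>g\<^sub>i\<close>, with \<open>a \<in> m\<close> and \<open>x\<close> in the ideal of the other generators,
  then so would \<open>x\<close>, as \<open>a g\<^sub>i\<close> has a larger valuation.
\<close>

lemma independent_val_not_in_max_mult:
  assumes gs: "minimal_gens I gs" and i: "i < length gs"
    and indep: "subdegree (gs ! i) \<notin> vals (span ((!) gs ` ({..<length gs} - {i})))"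
  shows "subdegree (gs ! i) \<notin> vals (max_mult I)"
proof
  let ?G = "(!) gs ` ({..<length gs} - {i})"
  define g where "g = gs ! i"
  assume "subdegree (gs ! i) \<in> vals (max_mult I)"
  then obtain y where y: "y \<in> max_mult I" "y \<noteq> 0" "subdegree y = subdegree g"
    unfolding g_def by (rule valsE)
  have set_gs: "set gs = insert g ?G" using i by (auto simp: in_set_conv_nth g_def)
  have GA: "g \<in> A" "?G \<subseteq> A" using gs set_gs unfolding minimal_gens_def by blast+
  have "I = span (insert g ?G)" using gs set_gs by (simp add: minimal_gens_def)
  then obtain a x where x: "y = a * g + x" "a $ 0 = 0" "x \<in> span ?G"
    using y(1) max_mult_span_insert[OF GA] by blast
  have low: "(a * g) $ l = 0" if "l \<le> subdegree g" for l
    unfolding fps_mult_nth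
  proof (intro sum.neutral ballI)
    fix k assume k: "k \<in> {0..l}"
    show "a $ k * g $ (l - k) = 0"
    proof (cases "k = 0")
      case False
      then have "l - k < subdegree g" using that k by auto
      then have "g $ (l - k) = 0" by (rule nth_less_subdegree_zero)
      then show ?thesis by simp
    qed (simp add: x(2))
  qed
  have "y $ l = x $ l" if "l \<le> subdegree g" for l using low[OF that] by (simp add: x(1))
  moreover have "y $ subdegree g \<noteq> 0" using y nth_subdegree_nonzero by metis
  moreover have "y $ l = 0" if "l < subdegree g" for l using y nth_less_subdegree_zero that by metis
  ultimately have "subdegree g \<in> vals (span ?G)" by (intro valsI_nth[OF x(3)]) auto
  then show False using indep by (simp add: g_def)
qed

text \<open>
  The hypotheses \<open>dim_le\<close> and \<open>dim_eq\<close> express \<open>dim I / m I = k\<close>: independent families have at most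
  \<open>k\<close> members, and those which also span have exactly \<open>k\<close>. The first bounds the set
  \<open>S = val(I) \<setminus> val(m I)\<close>, the second gives its cardinality.
\<close>

theorem unique_independent_valuations:
  assumes I: "is_ideal I"
    and dim_le: "\<And>m u. (\<And>i. i < m \<Longrightarrow> u i \<in> I) \<Longrightarrow> independent_mod (max_mult I) m u \<Longrightarrow> m \<le> k"
    and dim_eq: "\<And>m u. (\<And>i. i < m \<Longrightarrow> u i \<in> I) \<Longrightarrow> independent_mod (max_mult I) m u \<Longrightarrow>
      I = {(\<Sum>i<m. fps_const (c i) * u i) + n | c n. n \<in> max_mult I} \<Longrightarrow> m = k"
  shows "\<exists>!ns. \<exists>gs. minimal_gens I gs \<and> length gs = k \<and> independent_vals gs \<and> ns = map subdegree gs"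
proof -
  define N where "N = max_mult I"
  have N: "is_ideal N" "N \<subseteq> I" unfolding N_def by (rule max_mult_ideal max_mult_subset, fact I)+
  define S where "S = vals I - vals N"
  have "\<exists>g. g \<in> I \<and> g \<noteq> 0 \<and> subdegree g = s" if "s \<in> S" for s
    using that by (auto simp: S_def elim: valsE)
  then obtain g where g: "\<And>s. s \<in> S \<Longrightarrow> g s \<in> I \<and> g s \<noteq> 0 \<and> subdegree (g s) = s" by metis
  have indep: "independent_mod N (length ss) (\<lambda>i. g (ss ! i))" if "distinct ss" "set ss \<subseteq> S" for ss
  proof (rule independent_mod_if_vals)
    have in_S: "i < length ss \<Longrightarrow> ss ! i \<in> S" for i using that(2) nth_mem by blast
    show "g (ss ! i) \<noteq> 0" "subdegree (g (ss ! i)) \<notin> vals N" if "i < length ss" for i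
      using g[OF in_S[OF that]] in_S[OF that] by (auto simp: S_def)
    show "inj_on (\<lambda>i. subdegree (g (ss ! i))) {..<length ss}"
      using g in_S \<open>distinct ss\<close> by (intro inj_onI) (simp add: nth_eq_iff_index_eq)
  qed
  have "card T \<le> k" if "finite T" "T \<subseteq> S" for T
    using dim_le[OF _ indep[of "sorted_list_of_set T", unfolded N_def]] that g nth_mem
    by (metis distinct_sorted_list_of_set length_sorted_list_of_set set_sorted_list_of_set subsetD)
  then have fin: "finite S" by (meson finite_if_finite_subsets_card_bdd)
  define ss where "ss = sorted_list_of_set S"
  have ss: "sorted ss" "distinct ss" "set ss = S" "length ss = card S"
    using fin by (simp_all add: ss_def)
  define u where "u i = g (ss ! i)" for i
  define m where "m = card S"
  have in_S: "i < m \<Longrightarrow> ss ! i \<in> S" for i using ss nth_mem m_def by metis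
  have u: "u i \<in> I" "u i \<noteq> 0" "subdegree (u i) = ss ! i" if "i < m" for i
    using g[OF in_S[OF that]] by (auto simp: u_def)
  have u_indep: "independent_mod N m u"
    using indep[of ss] ss by (simp add: m_def u_def[abs_def])
  have inj: "inj_on (\<lambda>i. subdegree (u i)) {..<m}"
    using u ss by (intro inj_onI) (simp add: m_def nth_eq_iff_index_eq)
  define L where "L = {(\<Sum>i<m. fps_const (c i) * u i) + n | c n. n \<in> N}"
  have L: "is_ideal L" unfolding L_def N_def by (rule linear_span_ideal[OF I]) (use u in auto)
  have u_L: "u i \<in> L" if "i < m" for i
    unfolding L_def by (rule linear_span_contains) (use that ideal_zero[OF N(1)] in auto)
  have "L \<subseteq> I"
    unfolding L_def using N(2) u by (auto intro!: ideal_add[OF I] ideal_sum[OF I] ideal_scale[OF I])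
  have N_L: "N \<subseteq> L"
  proof
    fix n assume "n \<in> N"
    then show "n \<in> L" unfolding L_def by (intro CollectI exI[of _ "\<lambda>_. 0"] exI[of _ n]) simp
  qed
  have "vals I \<subseteq> vals L"
  proof
    fix v assume "v \<in> vals I"
    show "v \<in> vals L"
    proof (cases "v \<in> S")
      case True
      then obtain i where "i < m" "ss ! i = v" using ss by (metis in_set_conv_nth m_def)
      then show ?thesis using u[of i] u_L[of i] valsI by metis
    next
      case False
      then have "v \<in> vals N" using \<open>v \<in> vals I\<close> by (simp add: S_def)
      then show ?thesis using N_L by (auto simp: vals_def)
    qed
  qed
  then have IL: "I = L" by (rule ideal_eq_if_vals[OF I L \<open>L \<subseteq> I\<close>])
  have mk: "m = k"
    by (rule dim_eq[OF _ u_indep[unfolded N_def] IL[unfolded L_def N_def]]) (rule u(1))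
  define gs where "gs = map u [0..<m]"
  have gs: "length gs = m" "\<And>i. i < m \<Longrightarrow> gs ! i = u i" by (simp_all add: gs_def)
  have vals_gs: "map subdegree gs = ss"
    using u ss by (intro nth_equalityI) (auto simp: gs m_def)
  have gs_I: "set gs \<subseteq> I" using u by (auto simp: gs_def)
  have gs_A: "set gs \<subseteq> A" using gs_I ideal_subset[OF I] by blast
  have span_gs: "span (set gs) = I"
  proof (rule nakayama[OF I span_ideal[OF gs_A], symmetric])
    show "span (set gs) \<subseteq> I" by (rule span_minimal[OF I gs_I])
    fix K assume K: "is_ideal K" "span (set gs) \<subseteq> K" "max_mult I \<subseteq> K"
    have uK: "u i \<in> K" if "i < m" for i
    proof -
      have "u i \<in> set gs" using that by (simp add: gs_def)
      then show ?thesis using K(2) span_superset by blast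
    qed
    show "I \<subseteq> K"
      unfolding IL L_def using K(3) uK
      by (auto simp: N_def intro!: ideal_add[OF K(1)] ideal_sum[OF K(1)] ideal_scale[OF K(1)])
  qed
  have gs_indep: "subdegree (u i) \<notin> vals (span (u ` ({..<m} - {i})))" if i: "i < m" for i
  proof
    assume "subdegree (u i) \<in> vals (span (u ` ({..<m} - {i})))"
    then obtain w where w: "w \<in> span (u ` ({..<m} - {i}))" "w \<noteq> 0" "subdegree w = subdegree (u i)"
      by (rule valsE)
    let ?T = "{..<m} - {i}"
    let ?L = "{(\<Sum>l\<in>?T. fps_const (c l) * u l) + n | c n. n \<in> max_mult I}"
    have "is_ideal ?L" by (rule linear_span_ideal[OF I]) (use u in auto)
    moreover have "u ` ?T \<subseteq> ?L"
    proof (rule image_subsetI)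
      fix l assume "l \<in> ?T"
      then show "u l \<in> ?L"
        by (intro linear_span_contains) (use ideal_zero[OF N(1)] in \<open>auto simp: N_def\<close>)
    qed
    ultimately have "w \<in> ?L" using w(1) span_minimal by blast
    then obtain c n where n: "w = (\<Sum>l\<in>?T. fps_const (c l) * u l) + n" "n \<in> N"
      unfolding N_def by blast
    \<comment> \<open>With \<open>w\<close> in place of \<open>u i\<close> the valuations are the same, but \<open>n \<in> m I\<close> is a nontrivial combination.\<close>
    define u' where "u' = u(i := w)"
    define c' where "c' = (\<lambda>l. if l = i then 1 else - c l)"
    have "(\<Sum>l<m. fps_const (c' l) * u' l) =
        fps_const (c' i) * u' i + (\<Sum>l\<in>?T. fps_const (c' l) * u' l)"
      by (rule sum.remove) (use i in auto)
    also have "(\<Sum>l\<in>?T. fps_const (c' l) * u' l) = (\<Sum>l\<in>?T. - (fps_const (c l) * u l))"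
      by (rule sum.cong) (auto simp: c'_def u'_def fps_const_neg[symmetric] simp del: fps_const_neg)
    also have "fps_const (c' i) * u' i + (\<Sum>l\<in>?T. - (fps_const (c l) * u l)) = n"
      using n(1) by (simp add: c'_def u'_def sum_negf)
    finally have eq: "(\<Sum>l<m. fps_const (c' l) * u' l) = n" .
    have sub: "subdegree (u' l) = subdegree (u l)" for l using w(3) by (simp add: u'_def)
    have "independent_mod N m u'"
    proof (rule independent_mod_if_vals)
      show "u' l \<noteq> 0" if "l < m" for l using u(2)[OF that] w(2) by (simp add: u'_def)
      show "inj_on (\<lambda>l. subdegree (u' l)) {..<m}" using inj by (simp add: sub)
      show "subdegree (u' l) \<notin> vals N" if "l < m" for l
        using in_S[OF that] u(3)[OF that] by (simp add: sub S_def)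
    qed
    then have "c' i = 0" using eq n(2) i unfolding independent_mod_def by metis
    then show False by (simp add: c'_def)
  qed
  have img: "(!) gs ` ({..<length gs} - {i}) = u ` ({..<m} - {i})" for i
    unfolding gs(1) by (rule image_cong) (auto simp: gs)
  have "minimal_gens I gs"
    unfolding minimal_gens_def
  proof (intro conjI allI impI)
    show "distinct gs" using ss(2) distinct_map[of subdegree gs] vals_gs by simp
    fix S' assume S': "S' \<subset> set gs"
    have set_gs: "set gs = u ` {..<m}" by (auto simp: gs_def)
    from S' obtain x where "x \<in> set gs" "x \<notin> S'" by blast
    then obtain i where i: "i < m" "u i \<notin> S'" unfolding set_gs by blast
    have "S' \<subseteq> u ` ({..<m} - {i})" using psubset_imp_subset[OF S'] i(2) unfolding set_gs by blast
    then have S'_span: "span S' \<subseteq> span (u ` ({..<m} - {i}))" by (rule span_mono)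
    show "span S' \<noteq> I"
    proof
      assume "span S' = I"
      then have "u i \<in> span (u ` ({..<m} - {i}))" using S'_span u(1)[OF i(1)] by blast
      from valsI[OF this u(2)[OF i(1)]] show False using gs_indep[OF i(1)] by simp
    qed
  qed (fact gs_A span_gs)+
  moreover have "independent_vals gs"
    unfolding independent_vals_def
    using gs_indep by (auto simp: img vals_gs ss gs)
  ultimately have ex: "\<exists>gs. minimal_gens I gs \<and> length gs = k \<and> independent_vals gs \<and> ss = map subdegree gs"
    using gs(1) mk vals_gs by metis
  have unique: "map subdegree hs = ss"
    if hs: "minimal_gens I hs" "length hs = k" "independent_vals hs" for hs
  proof -
    have hs_I: "set hs \<subseteq> I" using hs(1) span_superset[of "set hs"] by (simp add: minimal_gens_def)
    have hs_indep: "subdegree (hs ! i) \<notin> vals (span ((!) hs ` ({..<length hs} - {i})))"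
      if "i < length hs" for i
      using hs(3) that by (simp add: independent_vals_def)
    have hs_nz: "hs ! i \<noteq> 0" if "i < length hs" for i
    proof -
      have "set hs \<subseteq> A" using hs(1) by (simp add: minimal_gens_def)
      then have "(!) hs ` ({..<length hs} - {i}) \<subseteq> A" by (auto simp: subset_iff)
      from ideal_zero[OF span_ideal[OF this]] not_redundant[OF hs(1) that] show ?thesis by metis
    qed
    have in_S': "subdegree (hs ! i) \<in> S" if "i < length hs" for i
      using independent_val_not_in_max_mult[OF hs(1) that hs_indep[OF that]]
        valsI[of "hs ! i" I] hs_nz[OF that] hs_I nth_mem[OF that] by (auto simp: S_def N_def)
    have "subdegree (hs ! i) \<noteq> subdegree (hs ! j)" if "i < length hs" "j < length hs" "i \<noteq> j" for i j
    proof
      assume eq: "subdegree (hs ! i) = subdegree (hs ! j)"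
      have "hs ! j \<in> span ((!) hs ` ({..<length hs} - {i}))"
        by (rule subsetD[OF span_superset]) (use that in auto)
      from valsI[OF this hs_nz[OF that(2)]] show False using hs_indep[OF that(1)] eq by simp
    qed
    then have dist: "distinct (map subdegree hs)" by (auto simp: distinct_conv_nth)
    have "set (map subdegree hs) \<subseteq> S" using in_S' by (auto simp: in_set_conv_nth)
    moreover have "card (set (map subdegree hs)) = card S"
      using distinct_card[OF dist] hs(2) mk by (simp add: m_def)
    ultimately have "set (map subdegree hs) = S" using fin by (intro card_subset_eq) auto
    then show ?thesis
      using dist ss hs(3) by (intro sorted_distinct_set_unique) (auto simp: independent_vals_def)
  qed
  show ?thesis
  proof (rule ex1I[of _ ss], rule ex)
    fix ns
    assume "\<exists>gs. minimal_gens I gs \<and> length gs = k \<and> independent_vals gs \<and> ns = map subdegree gs"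
    then obtain hs where "minimal_gens I hs" "length hs = k" "independent_vals hs"
      and ns: "ns = map subdegree hs" by (elim exE conjE)
    then show "ns = ss" unfolding ns by (intro unique)
  qed
qed

end

section \<open>The coordinate ring of the branch\<close>

lemma ring_of_type_algebra_simps [simp]:
  "carrier (ring_of_type_algebra :: 'b::comm_ring_1 ring) = UNIV"
  "a \<otimes>\<^bsub>(ring_of_type_algebra :: 'b ring)\<^esub> b = a * b"
  "a \<oplus>\<^bsub>(ring_of_type_algebra :: 'b ring)\<^esub> b = a + b"
  "\<one>\<^bsub>(ring_of_type_algebra :: 'b ring)\<^esub> = 1"
  "\<zero>\<^bsub>(ring_of_type_algebra :: 'b ring)\<^esub> = 0"
  by (simp_all add: ring_of_type_algebra_def)

lemma combine_eq_sum:
  fixes a u :: "nat \<Rightarrow> 'b::comm_ring_1"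
  shows "ring.combine ring_of_type_algebra (map a [0..<m]) (map u [0..<m]) = (\<Sum>i<m. a i * u i)"
proof -
  interpret ring "ring_of_type_algebra :: 'b ring" by (rule ring_from_type_algebra)
  have "combine (map a xs) (map u xs) = (\<Sum>x\<leftarrow>xs. a x * u x)" for xs
    by (induction xs) simp_all
  then show ?thesis by (simp add: interv_sum_list_conv_sum_set_nat atLeast0LessThan)
qed

lemma unit_if_nth_0_nonzero:
  fixes h :: "'a::field fps fps"
  assumes "h $ 0 $ 0 \<noteq> 0"
  obtains k where "h * k = 1"
proof -
  have "h $ 0 * inverse (h $ 0) = 1" using assms by (simp add: inverse_mult_eq_1')
  then have "h * fps_right_inverse h (inverse (h $ 0)) = 1" by (rule fps_right_inverse)
  then show ?thesis by (rule that)
qed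

text \<open>
  Either coordinate can serve as \<open>\<pi>\<close> if it is not zero. For a Puiseux parameterization it will be the one
  that is a power of \<open>t\<close>, and which one that is depends on the tangent of the curve.
\<close>

locale plane_branch =
  fixes f :: "'a::field fps fps" and p q \<pi> :: "'a fps"
  assumes irreducible: "Factorial_Ring.irreducible f" and root: "subst2 p q f = 0"
    and p_nth_0: "p $ 0 = 0" and q_nth_0: "q $ 0 = 0"
    and uniformizer: "\<pi> = p \<or> \<pi> = q" "\<pi> \<noteq> 0"
begin

sublocale series_algebra "range (subst2 p q)" \<pi>
proof
  show "fps_const c \<in> range (subst2 p q)" for c
    using subst2_scalar[of p q c] by (metis rangeI)
  show "a + b \<in> range (subst2 p q)" if "a \<in> range (subst2 p q)" "b \<in> range (subst2 p q)" for a b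
    using that by (auto simp: subst2_add[symmetric])
  show "a * b \<in> range (subst2 p q)" if "a \<in> range (subst2 p q)" "b \<in> range (subst2 p q)" for a b
    using that by (auto simp: subst2_mult[OF p_nth_0 q_nth_0, symmetric])
  show "b oo \<pi> \<in> range (subst2 p q)" for b
    using uniformizer(1) subst2_const[of p q b] subst2_in_y[OF q_nth_0, of p b] by (metis rangeI)
qed (use uniformizer p_nth_0 q_nth_0 in auto)

abbreviation "A \<equiv> range (subst2 p q)"
abbreviation "\<O> \<equiv> curve_ring f"
abbreviation "\<rho> \<equiv> param_map p q"

definition cls :: "'a fps fps \<Rightarrow> 'a fps fps set" where
  "cls h = (PIdl\<^bsub>fps2_ring\<^esub> f) +>\<^bsub>fps2_ring\<^esub> h"

lemma principal_ideal: "ideal (PIdl\<^bsub>fps2_ring\<^esub> f) fps2_ring"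
  by (rule cring.cgenideal_ideal[OF cring_from_type_algebra]) simp

lemma cls_hom: "ring_hom_ring fps2_ring \<O> cls"
  using ideal.rcos_ring_hom_ring[OF principal_ideal] by (simp add: curve_ring_def cls_def[abs_def])

lemma O_cring: "cring \<O>"
  unfolding curve_ring_def by (rule ideal.quotient_is_cring[OF principal_ideal cring_from_type_algebra])

lemma O_ring: "ring \<O>"
  using O_cring by (rule cring.axioms(1))

lemma O_carrier: "carrier \<O> = range cls"
  unfolding curve_ring_def FactRing_def A_RCOSETS_defs cls_def a_r_coset_def[symmetric] by auto

lemma O_carrierE:
  assumes "a \<in> carrier \<O>"
  obtains h where "a = cls h"
  using assms by (auto simp: O_carrier)

lemma cls_add: "cls (g + h) = cls g \<oplus>\<^bsub>\<O>\<^esub> cls h"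
  and cls_mult: "cls (g * h) = cls g \<otimes>\<^bsub>\<O>\<^esub> cls h"
  and cls_one: "cls 1 = \<one>\<^bsub>\<O>\<^esub>"
  and cls_zero: "cls 0 = \<zero>\<^bsub>\<O>\<^esub>"
proof -
  note hom = ring_hom_ring.homh[OF cls_hom]
  show "cls (g + h) = cls g \<oplus>\<^bsub>\<O>\<^esub> cls h" using ring_hom_add[OF hom, of g h] by simp
  show "cls (g * h) = cls g \<otimes>\<^bsub>\<O>\<^esub> cls h" using ring_hom_mult[OF hom, of g h] by simp
  show "cls 1 = \<one>\<^bsub>\<O>\<^esub>" using ring_hom_one[OF hom] by simp
  show "cls 0 = \<zero>\<^bsub>\<O>\<^esub>"
    using ring_hom_zero[OF hom ring_from_type_algebra O_ring] by simp
qed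

lemma cls_eq: "cls h = {h'. f dvd h' - h}"
proof -
  have "(\<exists>c. h' = c * f + h) \<longleftrightarrow> f dvd h' - h" for h'
    by (auto simp: dvd_def algebra_simps)
  then show ?thesis
    by (auto simp: cls_def a_r_coset_def r_coset_def cgenideal_def)
qed

lemma subst2_eq_0: "subst2 p q h = 0 \<longleftrightarrow> f dvd h"
  using uniformizer by (intro subst2_eq_0_iff_dvd[OF irreducible root p_nth_0 q_nth_0]) auto

lemma cls_eq_iff: "cls g = cls h \<longleftrightarrow> subst2 p q g = subst2 p q h"
proof
  assume eq: "cls g = cls h"
  have "g \<in> cls g" by (simp add: cls_eq)
  then have "g \<in> cls h" by (simp only: eq)
  then show "subst2 p q g = subst2 p q h"
    using subst2_eq_0[of "g - h"] by (simp add: cls_eq subst2_diff)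
next
  assume "subst2 p q g = subst2 p q h"
  then have gh: "f dvd g - h" using subst2_eq_0[of "g - h"] by (simp add: subst2_diff)
  have "f dvd x - g \<longleftrightarrow> f dvd x - h" for x
    using dvd_add_left_iff[OF gh, of "x - g"] by simp
  then show "cls g = cls h" by (simp add: cls_eq)
qed

lemma rho_cls: "\<rho> (cls h) = subst2 p q h"
proof -
  have "subst2 p q g = subst2 p q h" if "g \<in> cls h" for g
    using that subst2_eq_0[of "g - h"] by (simp add: cls_eq subst2_diff)
  moreover have "h \<in> cls h" by (simp add: cls_eq)
  ultimately have "subst2 p q ` cls h = {subst2 p q h}" by blast
  then show ?thesis by (simp add: param_map_def)
qed

lemma rho_add: "a \<in> carrier \<O> \<Longrightarrow> b \<in> carrier \<O> \<Longrightarrow> \<rho> (a \<oplus>\<^bsub>\<O>\<^esub> b) = \<rho> a + \<rho> b"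
  by (elim O_carrierE) (simp add: rho_cls subst2_add flip: cls_add)

lemma rho_mult: "a \<in> carrier \<O> \<Longrightarrow> b \<in> carrier \<O> \<Longrightarrow> \<rho> (a \<otimes>\<^bsub>\<O>\<^esub> b) = \<rho> a * \<rho> b"
  by (elim O_carrierE) (simp add: rho_cls subst2_mult[OF p_nth_0 q_nth_0] flip: cls_mult)

lemma rho_zero: "\<rho> \<zero>\<^bsub>\<O>\<^esub> = 0"
  by (simp add: rho_cls flip: cls_zero)

lemma rho_one: "\<rho> \<one>\<^bsub>\<O>\<^esub> = 1"
  by (simp add: rho_cls flip: cls_one)

lemma rho_inj: "inj_on \<rho> (carrier \<O>)"
  by (auto simp: inj_on_def O_carrier rho_cls cls_eq_iff)

lemma rho_image: "\<rho> ` carrier \<O> = A"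
  by (auto simp: O_carrier rho_cls image_image)

lemma rho_in: "a \<in> carrier \<O> \<Longrightarrow> \<rho> a \<in> A"
  using rho_image by blast

lemma rho_a_inv:
  assumes "a \<in> carrier \<O>"
  shows "\<rho> (\<ominus>\<^bsub>\<O>\<^esub> a) = - \<rho> a"
proof -
  interpret ring \<O> by (rule O_ring)
  have "\<rho> a + \<rho> (\<ominus>\<^bsub>\<O>\<^esub> a) = 0"
    using assms by (simp add: rho_add[symmetric] r_neg rho_zero)
  then show ?thesis by (simp add: eq_neg_iff_add_eq_0 add.commute)
qed

lemma ideal_image:
  assumes J: "ideal J \<O>"
  shows "is_ideal (\<rho> ` J)"
proof (rule is_idealI)
  note carr = ideal.Icarr[OF J]
  note add = additive_subgroup.a_closed[OF ideal.axioms(1)[OF J]]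
  show "\<rho> ` J \<subseteq> A" using carr rho_in by (intro image_subsetI) simp
  show "0 \<in> \<rho> ` J"
    using imageI[OF additive_subgroup.zero_closed[OF ideal.axioms(1)[OF J]], of \<rho>] rho_zero by simp
  show "x + y \<in> \<rho> ` J" if xy: "x \<in> \<rho> ` J" "y \<in> \<rho> ` J" for x y
  proof -
    obtain a b where ab: "x = \<rho> a" "y = \<rho> b" "a \<in> J" "b \<in> J" using xy by (elim imageE)
    then show ?thesis using imageI[OF add[OF ab(3,4)], of \<rho>] by (simp add: rho_add carr)
  qed
  show "a * x \<in> \<rho> ` J" if a: "a \<in> A" and x: "x \<in> \<rho> ` J" for a x
  proof -
    obtain b c where bc: "x = \<rho> b" "b \<in> J" "a = \<rho> c" "c \<in> carrier \<O>"
      using a x unfolding rho_image[symmetric] by (elim imageE)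
    then show ?thesis
      using imageI[OF ideal.I_l_closed[OF J bc(2,4)], of \<rho>] by (simp add: rho_mult carr)
  qed
qed

lemma ideal_preimage:
  assumes K: "is_ideal K"
  shows "ideal {a \<in> carrier \<O>. \<rho> a \<in> K} \<O>"
proof -
  interpret ring \<O> by (rule O_ring)
  show ?thesis
  proof (rule idealI)
    show "subgroup {a \<in> carrier \<O>. \<rho> a \<in> K} (add_monoid \<O>)"
    proof (rule add.subgroupI)
      show "{a \<in> carrier \<O>. \<rho> a \<in> K} \<noteq> {}"
        using ideal_zero[OF K] rho_zero zero_closed by force
      show "\<ominus>\<^bsub>\<O>\<^esub> a \<in> {a \<in> carrier \<O>. \<rho> a \<in> K}"
        if "a \<in> {a \<in> carrier \<O>. \<rho> a \<in> K}" for a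
        using that rho_a_inv[of a] ideal_uminus[OF K] a_inv_closed[of a] by simp
    qed (use ideal_add[OF K] in \<open>auto simp: rho_add\<close>)
    show "x \<otimes>\<^bsub>\<O>\<^esub> a \<in> {a \<in> carrier \<O>. \<rho> a \<in> K}" "a \<otimes>\<^bsub>\<O>\<^esub> x \<in> {a \<in> carrier \<O>. \<rho> a \<in> K}"
      if "a \<in> {a \<in> carrier \<O>. \<rho> a \<in> K}" "x \<in> carrier \<O>" for a x
      using that ideal_mult[OF K rho_in[OF that(2)], of "\<rho> a"]
      by (simp_all add: rho_mult mult.commute)
  qed (rule O_ring)
qed

lemma Idl_image:
  assumes S: "S \<subseteq> carrier \<O>"
  shows "\<rho> ` (Idl\<^bsub>\<O>\<^esub> S) = span (\<rho> ` S)"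
proof
  interpret ring \<O> by (rule O_ring)
  have SA: "\<rho> ` S \<subseteq> A" using S rho_in by blast
  have "Idl\<^bsub>\<O>\<^esub> S \<subseteq> {a \<in> carrier \<O>. \<rho> a \<in> span (\<rho> ` S)}"
    by (rule genideal_minimal[OF ideal_preimage[OF span_ideal[OF SA]]])
       (use S span_superset[of "\<rho> ` S"] in blast)
  then show "\<rho> ` (Idl\<^bsub>\<O>\<^esub> S) \<subseteq> span (\<rho> ` S)" by blast
  show "span (\<rho> ` S) \<subseteq> \<rho> ` (Idl\<^bsub>\<O>\<^esub> S)"
    by (rule span_minimal[OF ideal_image[OF genideal_ideal[OF S]] image_mono[OF genideal_self[OF S]]])
qed

lemma Idl_subset_carrier: "S \<subseteq> carrier \<O> \<Longrightarrow> Idl\<^bsub>\<O>\<^esub> S \<subseteq> carrier \<O>"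
  using ideal.Icarr[OF ring.genideal_ideal[OF O_ring]] by blast

lemma val_set_eq:
  assumes "J \<subseteq> carrier \<O>"
  shows "val_set f p q J = vals (\<rho> ` J)"
proof -
  have "\<rho> a = 0 \<longleftrightarrow> a = \<zero>\<^bsub>\<O>\<^esub>" if "a \<in> J" for a
  proof -
    have "\<zero>\<^bsub>\<O>\<^esub> \<in> carrier \<O>" using cls_zero O_carrier by (metis rangeI)
    then show ?thesis using inj_on_eq_iff[OF rho_inj, of a "\<zero>\<^bsub>\<O>\<^esub>"] that assms rho_zero by auto
  qed
  then have "\<rho> ` (J - {\<zero>\<^bsub>\<O>\<^esub>}) = \<rho> ` J - {0}" by auto
  moreover have "val_t p q = (\<lambda>a. subdegree (\<rho> a))" by (simp add: val_t_def fun_eq_iff)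
  ultimately show ?thesis unfolding val_set_def vals_def by (metis image_image)
qed

lemma minimal_generators_iff:
  assumes gs: "set gs \<subseteq> carrier \<O>" and I: "I \<subseteq> carrier \<O>"
  shows "minimal_generators f I gs \<longleftrightarrow> minimal_gens (\<rho> ` I) (map \<rho> gs)"
proof -
  have Idl_iff: "Idl\<^bsub>\<O>\<^esub> S = I \<longleftrightarrow> span (\<rho> ` S) = \<rho> ` I" if "S \<subseteq> set gs" for S
  proof -
    have S: "S \<subseteq> carrier \<O>" using that gs by blast
    show ?thesis
      unfolding Idl_image[OF S, symmetric]
      using inj_on_image_eq_iff[OF rho_inj Idl_subset_carrier[OF S] I] by blast
  qed
  have "distinct gs \<longleftrightarrow> distinct (map \<rho> gs)"
    using inj_on_subset[OF rho_inj gs] by (simp add: distinct_map)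
  moreover have "set (map \<rho> gs) \<subseteq> A" using gs rho_in by auto
  moreover have "(\<forall>S. S \<subset> set gs \<longrightarrow> Idl\<^bsub>\<O>\<^esub> S \<noteq> I) \<longleftrightarrow>
      (\<forall>S. S \<subset> set (map \<rho> gs) \<longrightarrow> span S \<noteq> \<rho> ` I)"
  proof -
    have inj: "inj_on \<rho> (set gs)" using inj_on_subset[OF rho_inj gs] .
    have "(\<forall>S. S \<subset> set (map \<rho> gs) \<longrightarrow> span S \<noteq> \<rho> ` I) \<longleftrightarrow>
        (\<forall>S. S \<subset> set gs \<longrightarrow> span (\<rho> ` S) \<noteq> \<rho> ` I)" (is "?l = ?r")
    proof
      assume l: ?l
      show ?r
      proof (intro allI impI)
        fix S assume "S \<subset> set gs"
        then have "\<rho> ` S \<subset> set (map \<rho> gs)" using image_strict_mono[OF inj] by simp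
        then show "span (\<rho> ` S) \<noteq> \<rho> ` I" using l by blast
      qed
    next
      assume r: ?r
      show ?l
      proof (intro allI impI)
        fix S assume S: "S \<subset> set (map \<rho> gs)"
        then obtain T where T: "T \<subseteq> set gs" "S = \<rho> ` T"
          by (metis list.set_map psubset_imp_subset subset_imageE)
        then have "T \<subset> set gs" using S by auto
        then show "span S \<noteq> \<rho> ` I" using r T(2) by blast
      qed
    qed
    moreover have "(\<forall>S. S \<subset> set gs \<longrightarrow> span (\<rho> ` S) \<noteq> \<rho> ` I) \<longleftrightarrow>
        (\<forall>S. S \<subset> set gs \<longrightarrow> Idl\<^bsub>\<O>\<^esub> S \<noteq> I)"
      using Idl_iff[OF psubset_imp_subset] by simp
    ultimately show ?thesis by simp
  qed
  ultimately show ?thesis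
    using gs Idl_iff[of "set gs"] unfolding minimal_generators_def minimal_gens_def by simp
qed

lemma independent_valuations_iff:
  assumes gs: "set gs \<subseteq> carrier \<O>"
  shows "independent_valuations f p q gs \<longleftrightarrow> independent_vals (map \<rho> gs)"
proof -
  have val: "val_t p q = subdegree \<circ> \<rho>" by (simp add: val_t_def fun_eq_iff)
  have "val_set f p q (Idl\<^bsub>\<O>\<^esub> ((!) gs ` ({..<length gs} - {i}))) =
      vals (span ((!) (map \<rho> gs) ` ({..<length gs} - {i})))" for i
  proof -
    have S: "(!) gs ` ({..<length gs} - {i}) \<subseteq> carrier \<O>" using gs by (auto simp: subset_iff)
    have "\<rho> ` ((!) gs ` ({..<length gs} - {i})) = (!) (map \<rho> gs) ` ({..<length gs} - {i})"
      by (auto simp: image_image)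
    then show ?thesis
      using val_set_eq[OF Idl_subset_carrier[OF S]] Idl_image[OF S] by simp
  qed
  then show ?thesis
    unfolding independent_valuations_def independent_vals_def by (simp add: val)
qed

definition maximal :: "'a fps fps set set" where
  "maximal = {a \<in> carrier \<O>. \<rho> a $ 0 = 0}"

lemma maximal_ideal: "ideal maximal \<O>"
proof -
  have "is_ideal {a \<in> A. a $ 0 = 0}"
    by (rule is_idealI) (use zero_in add_closed mult_closed in auto)
  from ideal_preimage[OF this] show ?thesis
    by (rule back_subst[of "\<lambda>J. ideal J \<O>"]) (auto simp: maximal_def rho_in)
qed

text \<open>
  A power series with nonzero constant term is invertible, so \<open>\<O>\<close> is local.
\<close>

lemma ideal_eq_carrier:
  assumes J: "ideal J \<O>" and a: "a \<in> J" "a \<notin> maximal"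
  shows "J = carrier \<O>"
proof -
  interpret ideal J \<O> by fact
  obtain h where h: "a = cls h" using Icarr[OF a(1)] by (rule O_carrierE)
  then have "h $ 0 $ 0 \<noteq> 0" using a by (auto simp: maximal_def rho_cls subst2_nth_0 O_carrier)
  then obtain k where "h * k = 1" by (rule unit_if_nth_0_nonzero)
  then have "\<one>\<^bsub>\<O>\<^esub> = a \<otimes>\<^bsub>\<O>\<^esub> cls k" by (simp add: h flip: cls_one cls_mult)
  then have "\<one>\<^bsub>\<O>\<^esub> \<in> J" using I_r_closed[OF a(1), of "cls k"] by (simp add: O_carrier)
  then show ?thesis by (rule one_imp_carrier)
qed

lemma one_not_maximal: "\<one>\<^bsub>\<O>\<^esub> \<notin> maximal"
  by (simp add: maximal_def rho_one)

lemma max_ideal_eq: "max_ideal f = maximal"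
  unfolding max_ideal_def
proof (rule the_equality)
  have one: "\<one>\<^bsub>\<O>\<^esub> \<in> carrier \<O>" using cls_one O_carrier by (metis rangeI)
  show "maximalideal maximal \<O>"
  proof (rule maximalidealI[OF maximal_ideal])
    show "carrier \<O> \<noteq> maximal" using one one_not_maximal by blast
    show "J = maximal \<or> J = carrier \<O>" if "ideal J \<O>" "maximal \<subseteq> J" for J
      using ideal_eq_carrier[OF that(1)] that(2) by blast
  qed
  show "M = maximal" if "maximalideal M \<O>" for M
  proof -
    interpret maximalideal M \<O> by fact
    have "M \<subseteq> maximal" using ideal_eq_carrier[OF is_ideal] I_notcarr by blast
    then have "maximal = M \<or> maximal = carrier \<O>"
      by (intro I_maximal[OF maximal_ideal]) (auto simp: maximal_def)
    then show ?thesis using one one_not_maximal by blast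
  qed
qed

lemma ideal_prod_image:
  assumes I: "ideal I \<O>"
  shows "\<rho> ` (maximal \<cdot>\<^bsub>\<O>\<^esub> I) = max_mult (\<rho> ` I)"
proof
  interpret ring \<O> by (rule O_ring)
  note N = max_mult_ideal[OF ideal_image[OF I]]
  have carr: "s \<in> carrier \<O>" if "s \<in> maximal \<cdot>\<^bsub>\<O>\<^esub> I" for s
    using ideal_prod_in_carrier[OF maximal_ideal I] that by blast
  have "\<rho> s \<in> max_mult (\<rho> ` I)" if "s \<in> maximal \<cdot>\<^bsub>\<O>\<^esub> I" for s
    using that
  proof induction
    case (prod i j)
    then have "\<rho> (i \<otimes>\<^bsub>\<O>\<^esub> j) = \<rho> i * \<rho> j" "\<rho> i \<in> A" "\<rho> i $ 0 = 0"
      using ideal.Icarr[OF I] by (auto simp: maximal_def rho_mult rho_in)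
    then show ?case using max_mult_mem[of "\<rho> i" "\<rho> j" "\<rho> ` I"] prod by simp
  next
    case (sum s1 s2)
    then show ?case using ideal_add[OF N] by (simp add: rho_add carr)
  qed
  then show "\<rho> ` (maximal \<cdot>\<^bsub>\<O>\<^esub> I) \<subseteq> max_mult (\<rho> ` I)" by blast
  show "max_mult (\<rho> ` I) \<subseteq> \<rho> ` (maximal \<cdot>\<^bsub>\<O>\<^esub> I)"
    unfolding max_mult_def
  proof (rule span_minimal[OF ideal_image[OF ideal_prod_is_ideal[OF maximal_ideal I]]], rule subsetI)
    fix y assume "y \<in> {a * g | a g. a \<in> A \<and> a $ 0 = 0 \<and> g \<in> \<rho> ` I}"
    then obtain a g where y: "y = a * \<rho> g" "a \<in> A" "a $ 0 = 0" "g \<in> I" by blast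
    then obtain b where b: "a = \<rho> b" "b \<in> carrier \<O>" using rho_image by blast
    then have "b \<otimes>\<^bsub>\<O>\<^esub> g \<in> maximal \<cdot>\<^bsub>\<O>\<^esub> I"
      using y by (intro ideal_prod.prod) (auto simp: maximal_def)
    moreover have "y = \<rho> (b \<otimes>\<^bsub>\<O>\<^esub> g)"
      using y b ideal.Icarr[OF I] by (simp add: rho_mult)
    ultimately show "y \<in> \<rho> ` (maximal \<cdot>\<^bsub>\<O>\<^esub> I)" by blast
  qed
qed

text \<open>
  The quotient \<open>\<O> / N\<close> receives a homomorphism \<open>\<Psi>\<close> from \<open>\<bbbK>[[x,y]]\<close>; linear combinations in it are images
  of linear combinations of power series, and these vanish in \<open>\<O> / N\<close> iff their values at \<open>(p,q)\<close>
  lie in the image of \<open>N\<close>. So linear independence and spanning in the quotient can be tested in \<open>\<bbbK>[[t]]\<close>.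
\<close>

lemma dimension_bounds:
  assumes I: "ideal I \<O>" and N: "ideal N \<O>" "\<one>\<^bsub>\<O>\<^esub> \<notin> N" and dim: "quot_dim f I N k"
    and u: "\<And>i. i < m \<Longrightarrow> u i \<in> \<rho> ` I" and indep: "independent_mod (\<rho> ` N) m u"
  shows "m \<le> k"
    and "\<rho> ` I \<subseteq> {(\<Sum>i<m. fps_const (c i) * u i) + n | c n. n \<in> \<rho> ` N} \<Longrightarrow> m = k"
proof -
  define Q where "Q = \<O> Quot N"
  define \<Psi> where "\<Psi> h = N +>\<^bsub>\<O>\<^esub> cls h" for h
  define C where "C c = fps_const (fps_const c)" for c :: 'a
  define K where "K = range (\<lambda>c. \<Psi> (C c))"
  define E where "E = (+>\<^bsub>\<O>\<^esub>) N ` I"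
  interpret N: ideal N \<O> by (rule N(1))
  have hom: "\<Psi> \<in> ring_hom fps2_ring Q"
    using ring_hom_trans[OF ring_hom_ring.homh[OF cls_hom] N.rcos_ring_hom]
    by (simp add: Q_def \<Psi>_def[abs_def] comp_def)
  have Q_ring: "ring Q" unfolding Q_def by (rule N.quotient_is_ring)
  interpret \<Psi>: ring_hom_ring fps2_ring Q \<Psi>
    using hom Q_ring by (intro ring_hom_ringI2 ring_from_type_algebra)
  have \<Psi>_zero: "\<Psi> h = \<zero>\<^bsub>Q\<^esub> \<longleftrightarrow> subst2 p q h \<in> \<rho> ` N" for h
  proof -
    have carr: "cls h \<in> carrier \<O>" by (simp add: O_carrier)
    have "\<Psi> h = \<zero>\<^bsub>Q\<^esub> \<longleftrightarrow> cls h \<in> N"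
      using N.a_rcos_const N.rcos_const_imp_mem carr by (auto simp: \<Psi>_def Q_def FactRing_def)
    also have "\<dots> \<longleftrightarrow> \<rho> (cls h) \<in> \<rho> ` N"
      using inj_on_image_mem_iff[OF rho_inj carr, of N] N.Icarr by blast
    finally show ?thesis by (simp add: rho_cls)
  qed
  have nontrivial: "\<one>\<^bsub>Q\<^esub> \<noteq> \<zero>\<^bsub>Q\<^esub>"
    using N.rcos_const_imp_mem[of "\<one>\<^bsub>\<O>\<^esub>"] N(2) N.one_closed by (auto simp: Q_def FactRing_def)
  have C_hom: "C \<in> ring_hom ring_of_type_algebra fps2_ring"
    by (rule ring_hom_memI) (simp_all add: C_def)
  have sub: "subfield K Q"
  proof -
    have F: "Ring.field (ring_of_type_algebra :: 'a ring)" by (rule field_from_type_algebra)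
    interpret ring_hom_ring "ring_of_type_algebra :: 'a ring" Q "\<Psi> \<circ> C"
      using ring_hom_trans[OF C_hom hom] Q_ring by (intro ring_hom_ringI2 ring_from_type_algebra)
    show ?thesis
      using img_is_subfield(2)[OF field.carrier_is_subfield[OF F] nontrivial]
      by (simp add: K_def comp_def)
  qed
  have dimQ: "ring.dimension Q k K E"
    using dim by (simp add: quot_dim_def Q_def K_def E_def \<Psi>_def C_def scalar_def cls_def)
  have "\<exists>h. subst2 p q h = u i \<and> cls h \<in> I" if "i < m" for i
    using u[OF that] ideal.Icarr[OF I] by (auto simp: rho_cls elim!: O_carrierE) (metis O_carrierE rho_cls)
  then obtain h where h: "\<And>i. i < m \<Longrightarrow> subst2 p q (h i) = u i \<and> cls (h i) \<in> I" by metis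
  define Us where "Us = map \<Psi> (map h [0..<m])"
  have Us: "set Us \<subseteq> carrier Q" "length Us = m" by (auto simp: Us_def)
  have UsE: "set Us \<subseteq> E" using h by (auto simp: Us_def E_def \<Psi>_def)
  have comb: "\<Psi>.S.combine (map \<Psi> (map (\<lambda>i. C (c i)) [0..<m])) Us = \<Psi> (\<Sum>i<m. C (c i) * h i)" for c
    unfolding Us_def by (subst \<Psi>.combine_hom) (simp_all add: combine_eq_sum)
  have phi: "subst2 p q (\<Sum>i<m. C (c i) * h i) = (\<Sum>i<m. fps_const (c i) * u i)" for c
  proof -
    have "subst2 p q (\<Sum>i\<in>T. C (c i) * h i) = (\<Sum>i\<in>T. fps_const (c i) * subst2 p q (h i))" for T
      by (induction T rule: infinite_finite_induct)
         (simp_all add: subst2_add subst2_mult[OF p_nth_0 q_nth_0] C_def subst2_scalar)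
    then show ?thesis using h by simp
  qed
  have coeffs: "\<exists>c. Ks = map \<Psi> (map (\<lambda>i. C (c i)) [0..<m])"
    if "length Ks = m" "set Ks \<subseteq> K" for Ks
  proof -
    have "\<exists>c. Ks ! i = \<Psi> (C c)" if "i < m" for i
    proof -
      have "Ks ! i \<in> K" using that \<open>length Ks = m\<close> \<open>set Ks \<subseteq> K\<close> nth_mem by blast
      then show ?thesis by (auto simp: K_def)
    qed
    then obtain c where "\<And>i. i < m \<Longrightarrow> Ks ! i = \<Psi> (C (c i))" by metis
    then have "Ks = map \<Psi> (map (\<lambda>i. C (c i)) [0..<m])"
      using that(1) by (intro nth_equalityI) auto
    then show ?thesis by blast
  qed
  have indQ: "\<Psi>.S.independent K Us"
  proof (rule ccontr)
    assume "\<Psi>.S.dependent K Us"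
    then obtain Ks where Ks: "length Ks = length Us" "\<Psi>.S.combine Ks Us = \<zero>\<^bsub>Q\<^esub>" "set Ks \<subseteq> K"
      "set Ks \<noteq> {\<zero>\<^bsub>Q\<^esub>}"
      by (rule \<Psi>.S.dependent_imp_non_trivial_combine[OF sub Us(1)])
    obtain c where c: "Ks = map \<Psi> (map (\<lambda>i. C (c i)) [0..<m])"
      using coeffs Ks(1,3) Us(2) by metis
    have "(\<Sum>i<m. fps_const (c i) * u i) \<in> \<rho> ` N"
      using Ks(2) unfolding c comb \<Psi>_zero phi .
    then have "c i = 0" if "i < m" for i using indep that unfolding independent_mod_def by blast
    then have "\<Psi> (C (c i)) = \<zero>\<^bsub>Q\<^esub>" if "i < m" for i
      using that \<Psi>.hom_zero by (simp add: C_def)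
    then have "set Ks \<subseteq> {\<zero>\<^bsub>Q\<^esub>}" by (auto simp: c)
    then have "Us = []" using Ks(1,4) by (metis length_0_conv set_empty subset_singletonD)
    then have "\<not> \<Psi>.S.independent K []" using \<open>\<Psi>.S.dependent K Us\<close> by simp
    then show False by simp
  qed
  show "m \<le> k"
    using \<Psi>.S.independent_length_le_dimension[OF sub dimQ indQ UsE] Us(2) by simp
  assume span: "\<rho> ` I \<subseteq> {(\<Sum>i<m. fps_const (c i) * u i) + n | c n. n \<in> \<rho> ` N}"
  have "E \<subseteq> \<Psi>.S.Span K Us"
  proof
    fix x assume "x \<in> E"
    then obtain a where a: "x = N +>\<^bsub>\<O>\<^esub> a" "a \<in> I" by (auto simp: E_def)
    obtain g where g: "a = cls g" using ideal.Icarr[OF I a(2)] by (rule O_carrierE)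
    have x: "x = \<Psi> g" by (simp add: a g \<Psi>_def)
    have "subst2 p q g \<in> \<rho> ` I" using a(2) g rho_cls by (metis imageI)
    then obtain c n where c: "subst2 p q g = (\<Sum>i<m. fps_const (c i) * u i) + n" "n \<in> \<rho> ` N"
      using span by blast
    define s where "s = (\<Sum>i<m. C (c i) * h i)"
    have "\<Psi> (g - s) = \<zero>\<^bsub>Q\<^esub>" using c by (simp add: \<Psi>_zero subst2_diff s_def phi)
    then have "\<Psi> g = \<Psi> s"
      using \<Psi>.hom_add[of "g - s" s] \<Psi>.hom_closed[of s] by simp
    then have "x = \<Psi>.S.combine (map \<Psi> (map (\<lambda>i. C (c i)) [0..<m])) Us"
      unfolding x comb by (simp only: s_def)
    moreover have "set (map \<Psi> (map (\<lambda>i. C (c i)) [0..<m])) \<subseteq> K" by (auto simp: K_def)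
    moreover have "length (map \<Psi> (map (\<lambda>i. C (c i)) [0..<m])) = length Us" using Us(2) by simp
    ultimately show "x \<in> \<Psi>.S.Span K Us"
      unfolding \<Psi>.S.Span_mem_iff_length_version[OF sub Us(1)] by blast
  qed
  moreover have "\<Psi>.S.Span K Us \<subseteq> E"
  proof
    fix x assume "x \<in> \<Psi>.S.Span K Us"
    then obtain Ks where Ks: "set Ks \<subseteq> K" "length Ks = length Us" "x = \<Psi>.S.combine Ks Us"
      unfolding \<Psi>.S.Span_mem_iff_length_version[OF sub Us(1)] by blast
    then obtain c where c: "Ks = map \<Psi> (map (\<lambda>i. C (c i)) [0..<m])"
      using coeffs Us(2) by metis
    have "(\<Sum>i<m. fps_const (c i) * u i) \<in> \<rho> ` I"
      by (intro ideal_sum[OF ideal_image[OF I]] ideal_scale[OF ideal_image[OF I]]) (simp add: u)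
    then have "\<rho> (cls (\<Sum>i<m. C (c i) * h i)) \<in> \<rho> ` I" by (simp add: rho_cls phi)
    then have "cls (\<Sum>i<m. C (c i) * h i) \<in> I"
      using inj_on_image_mem_iff[OF rho_inj, of "cls (\<Sum>i<m. C (c i) * h i)" I] ideal.Icarr[OF I]
      by (auto simp: O_carrier)
    then show "x \<in> E" unfolding Ks(3) c comb by (simp add: E_def \<Psi>_def)
  qed
  ultimately have "\<Psi>.S.Span K Us = E" by blast
  then have "ring.dimension Q m K E"
    using \<Psi>.S.dimensionI[OF sub indQ] Us(2) by simp
  then show "m = k" using \<Psi>.S.dimension_is_inj[OF sub dimQ] by simp
qed

theorem unique_independent_generators:
  assumes I: "ideal I \<O>" and dim: "quot_dim f I (max_ideal f \<cdot>\<^bsub>\<O>\<^esub> I) k"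
  shows "\<exists>!ns. \<exists>gs. minimal_generators f I gs \<and> length gs = k \<and>
    independent_valuations f p q gs \<and> ns = map (val_t p q) gs"
proof -
  interpret ring \<O> by (rule O_ring)
  let ?N = "maximal \<cdot>\<^bsub>\<O>\<^esub> I"
  have N: "ideal ?N \<O>" "\<one>\<^bsub>\<O>\<^esub> \<notin> ?N"
    using ideal_prod_is_ideal[OF maximal_ideal I] ideal_prod_inter[OF maximal_ideal I]
      one_not_maximal by auto
  note bounds = dimension_bounds[OF I N dim[unfolded max_ideal_eq], unfolded ideal_prod_image[OF I]]
  have IC: "I \<subseteq> carrier \<O>" using ideal.Icarr[OF I] by blast
  have *: "\<exists>!ns. \<exists>gs. minimal_gens (\<rho> ` I) gs \<and> length gs = k \<and> independent_vals gs \<and>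
      ns = map subdegree gs"
    by (rule unique_independent_valuations[OF ideal_image[OF I]])
       (rule bounds(1), assumption+, rule bounds(2), assumption+, simp)
  \<comment> \<open>Applying the parameterization is a bijection between the lists of generators on both sides.\<close>
  have "(\<exists>gs. minimal_generators f I gs \<and> length gs = k \<and>
      independent_valuations f p q gs \<and> ns = map (val_t p q) gs) \<longleftrightarrow>
    (\<exists>gs. minimal_gens (\<rho> ` I) gs \<and> length gs = k \<and> independent_vals gs \<and>
      ns = map subdegree gs)" (is "?l = ?r") for ns
  proof
    assume ?l
    then obtain gs where gs: "minimal_generators f I gs" "length gs = k"
      "independent_valuations f p q gs" "ns = map (val_t p q) gs" by blast
    then have carr: "set gs \<subseteq> carrier \<O>" by (simp add: minimal_generators_def)
    have "ns = map subdegree (map \<rho> gs)" using gs(4) by (simp add: val_t_def)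
    then show ?r
      using gs minimal_generators_iff[OF carr IC] independent_valuations_iff[OF carr]
      by (intro exI[of _ "map \<rho> gs"]) simp
  next
    assume ?r
    then obtain hs where hs: "minimal_gens (\<rho> ` I) hs" "length hs = k" "independent_vals hs"
      "ns = map subdegree hs" by blast
    then have "set hs \<subseteq> \<rho> ` carrier \<O>" unfolding minimal_gens_def rho_image by blast
    then have "hs \<in> map \<rho> ` lists (carrier \<O>)"
      unfolding lists_image[symmetric] by (simp add: in_lists_conv_set subset_iff)
    then obtain gs where hs_eq: "hs = map \<rho> gs" and carr: "set gs \<subseteq> carrier \<O>"
      by (auto simp: in_lists_conv_set)
    have "ns = map (val_t p q) gs" using hs(4) by (simp add: val_t_def hs_eq)
    then show ?l
      using hs minimal_generators_iff[OF carr IC] independent_valuations_iff[OF carr]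
      by (intro exI[of _ gs]) (simp add: hs_eq)
  qed
  with * show ?thesis by simp
qed

end

lemma curve_mult_pos:
  assumes "unibranch f"
  shows "curve_mult f > 0"
proof -
  have f: "f \<noteq> 0" "f $ 0 $ 0 = 0" using assms by (auto simp: unibranch_def)
  then obtain j where "f $ j \<noteq> 0" by (auto simp: fps_eq_iff)
  then obtain i where "f $ j $ i \<noteq> 0" by (auto simp: fps_eq_iff)
  then have "\<exists>d i j. i + j = d \<and> f $ j $ i \<noteq> 0" by blast
  from LeastI_ex[OF this] have "\<exists>i j. i + j = curve_mult f \<and> f $ j $ i \<noteq> 0"
    by (simp add: curve_mult_def)
  then show ?thesis using f(2) by (metis add_is_0 gr0I)
qed

lemma plane_branch_if_puiseux_param:
  assumes "unibranch f" "puiseux_param f p q"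
  shows "plane_branch f p q (fps_X ^ curve_mult f)"
proof
  note pos = curve_mult_pos[OF assms(1)]
  show "Factorial_Ring.irreducible f" using assms(1) by (simp add: unibranch_def)
  show "subst2 p q f = 0" using assms(2) by (simp add: puiseux_param_def)
  show "p $ 0 = 0" "q $ 0 = 0" "fps_X ^ curve_mult f = p \<or> fps_X ^ curve_mult f = q"
    using assms(2) pos by (auto simp: puiseux_param_def puiseux_pair_def)
qed simp

theorem theorem1p1:
  fixes f :: "'a::{alg_closed_field, field_char_0} fps fps"
    and p q :: "'a fps"
    and n k :: nat
    and I :: "'a fps fps set set"
  assumes "unibranch f"
    and "puiseux_param f p q"
    and "n \<ge> 1" and "k \<ge> 1"
    and "I \<in> Hilb_gen f n k"
  shows "\<exists>!ns. \<exists>gs. minimal_generators f I gs \<and> length gs = k \<and>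
           independent_valuations f p q gs \<and> ns = map (val_t p q) gs"
proof (rule plane_branch.unique_independent_generators)
  show "plane_branch f p q (fps_X ^ curve_mult f)"
    using assms(1,2) by (rule plane_branch_if_puiseux_param)
  show "ideal I (curve_ring f)" "quot_dim f I (max_ideal f \<cdot>\<^bsub>curve_ring f\<^esub> I) k"
    using assms(5) by (auto simp: Hilb_gen_def Hilb_def)
qed

end
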